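(* Let $n\ge 3$ be an integer and let $H_n\subseteq M_n(\mathbb{C})$ be the real vector space of $n\times n$ self-adjoint complex matrices. The continuous CS-preserving maps $\phi:H_n\to M_n(\mathbb{C})$ are precisely those of one of the following forms: (a) $\phi(X)=TXT^{-1}$ for all $X\in H_n$, or $\phi(X)=TX^{t}T^{-1}$ for all $X\in H_n$, for some $T\in \mathrm{GL}(n,\mathbb{C})$ (where $X^t$ is the transpose of $X$); (b) $\phi(X)=T\,\mathrm{diag}(\eta_1(X),\dots,\eta_n(X))\,T^{-1}$ for all $X\in H_n$, for some $T\in \mathrm{GL}(n,\mathbb{C})$, where $\eta_1(X)\le \cdots\le \eta_n(X)$ are the (real) eigenvalues of $X$, counted with multiplicity and listed in non-decreasing order.
   Context: $M_n(\mathbb{C})$ is the space of $n\times n$ complex matrices. A map $\phi$ from a subset of $M_n(\mathbb{C})$ to $M_n(\mathbb{C})$ is commutativity-preserving if $\phi(X)$ and $\phi(Y)$ commute whenever $X$ and $Y$ (in the domain) commute; it is spectrum-preserving if $X$ and $\phi(X)$ have the same spectrum (set of eigenvalues in $\mathbb{C}$) for every $X$ in the domain; and it is CS-preserving if both conditions hold. *)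

theory Defs
  imports "HOL-Analysis.Analysis" "HOL-Computational_Algebra.Computational_Algebra"
begin

type_synonym 'n cmatrix = "complex^'n^'n"

definition spectrum :: "('n::finite) cmatrix \<Rightarrow> complex set" where
  "spectrum X = {c. \<exists>v. v \<noteq> 0 \<and> X *v v = c *s v}"

definition commutativity_preserving_on ::
    "('n::finite) cmatrix set \<Rightarrow> ('n cmatrix \<Rightarrow> 'n cmatrix) \<Rightarrow> bool" where
  "commutativity_preserving_on S \<phi> \<longleftrightarrow>
     (\<forall>X\<in>S. \<forall>Y\<in>S. X ** Y = Y ** X \<longrightarrow> \<phi> X ** \<phi> Y = \<phi> Y ** \<phi> X)"

definition spectrum_preserving_on ::
    "('n::finite) cmatrix set \<Rightarrow> ('n cmatrix \<Rightarrow> 'n cmatrix) \<Rightarrow> bool" where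
  "spectrum_preserving_on S \<phi> \<longleftrightarrow> (\<forall>X\<in>S. spectrum (\<phi> X) = spectrum X)"

definition CS_preserving_on ::
    "('n::finite) cmatrix set \<Rightarrow> ('n cmatrix \<Rightarrow> 'n cmatrix) \<Rightarrow> bool" where
  "CS_preserving_on S \<phi> \<longleftrightarrow>
     commutativity_preserving_on S \<phi> \<and> spectrum_preserving_on S \<phi>"

definition self_adjoint_matrices :: "('n::finite) cmatrix set" where
  "self_adjoint_matrices = {X. map_matrix cnj (transpose X) = X}"

definition charpoly :: "('n::finite) cmatrix \<Rightarrow> complex poly" where
  "charpoly X = det (mat [:0, 1:] - map_matrix (\<lambda>c. [:c:]) X)"

text \<open>
  The eigenvalues of a self-adjoint matrix, with multiplicity, in non-decreasing order.
  They are real, so \<^const>\<open>Re\<close> only changes their type; for a matrix that is not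
  self-adjoint this list is not meaningful.
\<close>

definition sorted_eigenvalues :: "('n::finite) cmatrix \<Rightarrow> real list" where
  "sorted_eigenvalues X = sorted_list_of_multiset (image_mset Re (proots (charpoly X)))"

text \<open>
  Rows and columns are indexed by a finite linearly ordered type. An index \<open>i\<close> is the
  \<open>(k+1)\<close>-st one for \<open>k = card {j. j < i}\<close>, while list positions start at 0.
\<close>

definition sorted_eigenvalue_diag ::
    "('n::{finite,linorder}) cmatrix \<Rightarrow> 'n cmatrix" where
  "sorted_eigenvalue_diag X =
     (\<chi> i j. if i = j then complex_of_real (sorted_eigenvalues X ! card {k. k < i}) else 0)"

end

(*
Let phi be continuous and CS-preserving. For a fixed orthonormal frame u, the matrices with
eigenvectors u have commuting images, and those with increasing eigenvalues d are mapped to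
T diag(d) T^-1 for one T, because the eigenvalues cannot change places on the connected chamber of
strictly increasing d. So projections go to idempotents of the same rank, compatibly with inclusion.
For orthogonal unit vectors a, b the images of the lines through a and b are rank-one idempotents
that coincide or annihilate each other, and since the set of orthonormal pairs is connected (n >= 3)
only one of the two cases occurs.

If they coincide, the images of the projections of each rank are shown to be constant (pigeonhole
among three planes of a three-dimensional space, and connectedness again), so T does not depend on u:
this is the sorted-eigenvalue map.

If they annihilate each other, f(x) = phi(x x^* / |x|^2) sends orthogonal vectors to idempotents with
product 0. Expressed in coordinates, f(x) is determined by a single function g : C -> C of the
coordinate ratios; g is multiplicative (rank one), additive (orthogonality of (1,1,1) and (1,a,b) when
1 + a + b = 0, up to conjugation) and continuous, hence the identity or the conjugation. These give
T X T^-1 and T X^t T^-1 on projections, hence by the spectral theorem on all self-adjoint matrices.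
*)
theory Submission
  imports Defs
begin

no_notation fps_nth (infixl \<open>$\<close> 75)

section \<open>Conjugation and diagonal matrices\<close>

text \<open>Commutation relates only matrices that share a frame, so each frame brings its own T and
  nothing a priori compares the T of two frames. The comparison goes through projections, which
  belong to the commutative families of many frames at once. What makes it rigid is an integer: two
  projections from one frame are sent to idempotents diagonal in a common basis, and the trace of
  their product counts the common indices. Being continuous, this count is constant on a connected
  family; the third dimension supplies a vector orthogonal to two given ones, through which any two
  orthogonal pairs are joined. In the annihilating case the delicate point is that coordinate ratios
  of f(x) make sense at all: a priori the diagonal entry at i might vanish although x_i does not,
  and a boundary argument in three coordinates excludes this. A diagonal change of basis then
  normalizes the ratios to be 1 at 1, which makes them independent of the indices.\<close>

definition diag_mat :: "('n::finite \<Rightarrow> complex) \<Rightarrow> 'n cmatrix" where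
  "diag_mat a = (\<chi> i j. if i = j then a i else 0)"

lemma matrix_inv_right: "invertible T \<Longrightarrow> T ** matrix_inv T = mat 1"
  and matrix_inv_left: "invertible T \<Longrightarrow> matrix_inv T ** T = mat 1"
  for T :: "'n::finite cmatrix"
  unfolding invertible_def matrix_inv_def by (metis (mono_tags, lifting) someI_ex)+

lemma invertible_matrix_inv: "invertible T \<Longrightarrow> invertible (matrix_inv T)"
  for T :: "'n::finite cmatrix"
  unfolding invertible_def using matrix_inv_left matrix_inv_right invertible_def by metis

lemma matrix_inv_unique: "A ** B = mat 1 \<Longrightarrow> matrix_inv A = B"
  for A :: "'n::finite cmatrix"
  by (metis invertible_right_inverse matrix_inv_left matrix_mul_assoc matrix_mul_lid matrix_mul_rid)

lemma conj_mult:
  fixes T :: "'n::finite cmatrix"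
  assumes "invertible T"
  shows "(T ** A ** matrix_inv T) ** (T ** B ** matrix_inv T) = T ** (A ** B) ** matrix_inv T"
proof -
  have "(T ** A ** matrix_inv T) ** (T ** B ** matrix_inv T)
      = T ** A ** (matrix_inv T ** T) ** B ** matrix_inv T"
    by (simp add: matrix_mul_assoc)
  then show ?thesis by (simp add: matrix_inv_left[OF assms] matrix_mul_assoc)
qed

lemma conj_cancel:
  fixes T :: "'n::finite cmatrix"
  assumes "invertible T"
  shows "matrix_inv T ** (T ** A ** matrix_inv T) ** T = A"
    and "T ** (matrix_inv T ** A ** T) ** matrix_inv T = A"
proof -
  have "matrix_inv T ** (T ** A ** matrix_inv T) ** T = (matrix_inv T ** T) ** A ** (matrix_inv T ** T)"
    by (simp only: matrix_mul_assoc)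
  then show "matrix_inv T ** (T ** A ** matrix_inv T) ** T = A"
    by (simp add: matrix_inv_left[OF assms])
  have "T ** (matrix_inv T ** A ** T) ** matrix_inv T = (T ** matrix_inv T) ** A ** (T ** matrix_inv T)"
    by (simp only: matrix_mul_assoc)
  then show "T ** (matrix_inv T ** A ** T) ** matrix_inv T = A"
    by (simp add: matrix_inv_right[OF assms])
qed

lemma conj_inject:
  fixes T :: "'n::finite cmatrix"
  assumes "invertible T"
  shows "T ** A ** matrix_inv T = T ** B ** matrix_inv T \<longleftrightarrow> A = B"
  by (metis conj_cancel(1)[OF assms])

lemma trace_conj:
  fixes T :: "'n::finite cmatrix"
  assumes "invertible T"
  shows "trace (T ** A ** matrix_inv T) = trace A"
  by (metis assms matrix_inv_left matrix_mul_assoc matrix_mul_rid trace_mul_sym)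

lemma matrix_add_rdistrib': "(A + B) ** C = A ** C + B ** (C::'n::finite cmatrix)"
  by (simp add: matrix_matrix_mult_def vec_eq_iff sum.distrib distrib_right)

lemma matrix_mult_scaleR:
  "(r *\<^sub>R A) ** B = r *\<^sub>R (A ** B)" "A ** (r *\<^sub>R B) = r *\<^sub>R (A ** B)"
  for A :: "'n::finite cmatrix"
  by (simp_all add: matrix_matrix_mult_def vec_eq_iff scaleR_sum_right)

lemma matrix_mult_sum:
  "(\<Sum>i\<in>S. f i) ** B = (\<Sum>i\<in>S. f i ** B)" "B ** (\<Sum>i\<in>S. f i) = (\<Sum>i\<in>S. B ** f i)"
  for B :: "'n::finite cmatrix"
  by (induction S rule: infinite_finite_induct)
    (simp_all add: matrix_add_ldistrib matrix_add_rdistrib')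

lemma diag_mat_mult_left: "(diag_mat a ** M) $ i $ j = a i * M $ i $ j"
  by (simp add: diag_mat_def matrix_matrix_mult_def if_distrib if_distribR cong: if_cong)

lemma diag_mat_mult_right: "(M ** diag_mat a) $ i $ j = M $ i $ j * a j"
  by (simp add: diag_mat_def matrix_matrix_mult_def if_distrib if_distribR cong: if_cong)

lemma diag_mat_mult: "diag_mat a ** diag_mat b = diag_mat (\<lambda>i. a i * b i)"
  by (simp add: vec_eq_iff diag_mat_mult_left) (simp add: diag_mat_def)

lemma diag_mat_inject: "diag_mat a = diag_mat b \<longleftrightarrow> a = b"
  by (auto simp: diag_mat_def vec_eq_iff fun_eq_iff)

lemma trace_diag_mat: "trace (diag_mat a) = (\<Sum>i\<in>UNIV. a i)"
  by (simp add: diag_mat_def trace_def)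

lemma diag_mat_one: "diag_mat (\<lambda>_. 1) = mat 1"
  by (simp add: diag_mat_def mat_def)

lemma diag_mat_mult_vec: "(diag_mat a *v x) $ i = a i * x $ i"
  by (simp add: diag_mat_def matrix_vector_mult_def if_distrib if_distribR cong: if_cong)

lemma commute_diag_mat_imp_diag:
  assumes "M ** diag_mat a = diag_mat a ** M" "inj a"
  shows "M = diag_mat (\<lambda>i. M $ i $ i)"
proof -
  have "M $ i $ j = 0" if "i \<noteq> j" for i j
  proof -
    have "(M ** diag_mat a) $ i $ j = (diag_mat a ** M) $ i $ j" using assms by simp
    then have "M $ i $ j * a j = a i * M $ i $ j"
      by (simp add: diag_mat_mult_left diag_mat_mult_right)
    moreover have "a i \<noteq> a j" using that assms(2) by (auto dest: injD)
    ultimately show ?thesis by (simp add: mult.commute)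
  qed
  then show ?thesis by (auto simp: diag_mat_def vec_eq_iff)
qed

lemma spectrum_conj:
  fixes T :: "'n::finite cmatrix"
  assumes "invertible T"
  shows "spectrum (T ** A ** matrix_inv T) = spectrum A"
proof -
  have sub: "spectrum A \<subseteq> spectrum (S ** A ** R)" if "S ** R = mat 1" "R ** S = mat 1"
    for S R A :: "'n cmatrix"
  proof
    fix c assume "c \<in> spectrum A"
    then obtain v where v: "v \<noteq> 0" "A *v v = c *s v" by (auto simp: spectrum_def)
    have "R *v (S *v v) = v" using that by (simp add: matrix_vector_mul_assoc)
    moreover from this have "S *v v \<noteq> 0" using v(1) by auto
    moreover have "(S ** A ** R) *v (S *v v) = S *v (A *v (R *v (S *v v)))"
      by (simp add: matrix_vector_mul_assoc matrix_mul_assoc)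
    ultimately have "(S ** A ** R) *v (S *v v) = c *s (S *v v)"
      using v by (simp add: vector_scalar_commute)
    then show "c \<in> spectrum (S ** A ** R)" using \<open>S *v v \<noteq> 0\<close> by (auto simp: spectrum_def)
  qed
  have "spectrum (T ** A ** matrix_inv T)
      \<subseteq> spectrum (matrix_inv T ** (T ** A ** matrix_inv T) ** T)"
    using assms by (intro sub matrix_inv_left matrix_inv_right)
  moreover have "spectrum A \<subseteq> spectrum (T ** A ** matrix_inv T)"
    using assms by (intro sub matrix_inv_left matrix_inv_right)
  ultimately show ?thesis by (simp add: conj_cancel[OF assms])
qed

lemma spectrum_diag_mat: "spectrum (diag_mat a) = range a"
proof (intro equalityI subsetI)
  fix c assume "c \<in> spectrum (diag_mat a)"
  then obtain v where v: "v \<noteq> 0" "diag_mat a *v v = c *s v" by (auto simp: spectrum_def)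
  then obtain i where "v $ i \<noteq> 0" by (auto simp: vec_eq_iff)
  moreover have "a i * v $ i = c * v $ i" by (metis v(2) diag_mat_mult_vec vector_smult_component)
  ultimately show "c \<in> range a" by auto
next
  fix c assume "c \<in> range a"
  then obtain i where i: "c = a i" by auto
  have "diag_mat a *v axis i 1 = c *s axis i 1"
    by (auto simp: vec_eq_iff diag_mat_mult_vec i axis_def)
  moreover have "axis i (1::complex) \<noteq> 0" by (simp add: axis_eq_0_iff)
  ultimately show "c \<in> spectrum (diag_mat a)" unfolding spectrum_def by blast
qed

text \<open>Eigenvectors for distinct eigenvalues are independent, so they are the columns of an
  invertible T with \<open>A ** T = T ** diag_mat a\<close>. In this way knowledge of a spectrum
  alone yields a diagonalization.\<close>

lemma invertible_of_eigenvectors: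
  fixes A :: "'n::finite cmatrix" and w :: "'n \<Rightarrow> complex^'n" and a :: "'n \<Rightarrow> complex"
  assumes eig: "\<And>i. A *v w i = a i *s w i" and nz: "\<And>i. w i \<noteq> 0" and inj: "inj a"
  shows "\<exists>T. invertible T \<and> A = T ** diag_mat a ** matrix_inv T"
proof -
  have indep: "finite S \<Longrightarrow> (\<Sum>i\<in>S. c i *s w i) = 0 \<Longrightarrow> \<forall>i\<in>S. c i = 0" for S c
  proof (induction S arbitrary: c rule: finite_induct)
    case (insert s S)
    \<comment> \<open>Apply A to the relation and subtract \<open>a s\<close> times it: the term at
      s cancels and the others acquire the nonzero factors \<open>a i - a s\<close>.\<close>
    have "A *v (\<Sum>i\<in>insert s S. c i *s w i) - a s *s (\<Sum>i\<in>insert s S. c i *s w i) = 0"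
      using insert.prems by simp
    also have "A *v (\<Sum>i\<in>insert s S. c i *s w i) = (\<Sum>i\<in>insert s S. c i *s (a i *s w i))"
      by (simp add: vec.linear_sum[OF matrix_vector_mul_linear_gen] vector_scalar_commute eig
          del: sum.insert vector_smult_assoc)
    finally have "(\<Sum>i\<in>insert s S. (c i * (a i - a s)) *s w i) = 0"
      by (simp add: vec.scale_sum_right sum_subtractf[symmetric] vector_smult_assoc
          algebra_simps vector_sub_rdistrib del: sum.insert)
    then have "(\<Sum>i\<in>S. (c i * (a i - a s)) *s w i) = 0" using insert.hyps by simp
    from insert.IH[OF this] have 0: "\<forall>i\<in>S. c i = 0"
      using inj insert.hyps by (auto dest: injD)
    then have "c s *s w s = 0" using insert.prems insert.hyps by simp
    then show ?case using 0 nz[of s] by (auto simp: vec.scale_eq_0_iff)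
  qed simp
  define T :: "'n cmatrix" where "T = (\<chi> i j. w j $ i)"
  have "column i T = w i" for i by (simp add: T_def column_def vec_eq_iff)
  then have "\<exists>B. B ** T = mat 1"
    using indep[of UNIV] by (simp add: matrix_left_invertible_independent_columns)
  then have inv: "invertible T" by (simp add: invertible_left_inverse)
  have "(A ** T) $ i $ j = (A *v w j) $ i" for i j
    by (simp add: matrix_matrix_mult_def matrix_vector_mult_def T_def)
  then have "A ** T = T ** diag_mat a"
    by (simp add: vec_eq_iff eig diag_mat_mult_right T_def mult.commute)
  then have "A = T ** diag_mat a ** matrix_inv T"
    by (metis inv matrix_inv_right matrix_mul_assoc matrix_mul_rid)
  then show ?thesis using inv by blast
qed

section \<open>Orthonormal systems\<close>

definition cip :: "complex^'n \<Rightarrow> complex^'n \<Rightarrow> complex" where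
  "cip x y = (\<Sum>i\<in>UNIV. x $ i * cnj (y $ i))"

definition outer :: "complex^'n \<Rightarrow> ('n::finite) cmatrix" where
  "outer x = (\<chi> i j. x $ i * cnj (x $ j))"

definition orthonormal :: "(complex^'n) set \<Rightarrow> bool" where
  "orthonormal B \<longleftrightarrow> finite B \<and> (\<forall>x\<in>B. \<forall>y\<in>B. cip x y = (if x = y then 1 else 0))"

definition proj :: "(complex^'n) set \<Rightarrow> ('n::finite) cmatrix" where
  "proj B = (\<Sum>b\<in>B. outer b)"

definition frame :: "('n::finite \<Rightarrow> complex^'n) \<Rightarrow> bool" where
  "frame u \<longleftrightarrow> (\<forall>i j. cip (u i) (u j) = (if i = j then 1 else 0))"

text \<open>For a frame u this is the self-adjoint matrix with eigenvectors \<open>u i\<close> and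
  eigenvalues \<open>d $ i\<close>. The eigenvalues form a vector rather than a function, so that
  sets of them are subsets of a Euclidean space.\<close>

definition spec :: "('n::finite \<Rightarrow> complex^'n) \<Rightarrow> real^'n \<Rightarrow> 'n cmatrix" where
  "spec u d = (\<Sum>i\<in>UNIV. d $ i *\<^sub>R outer (u i))"

lemma cip_cnj: "cnj (cip x y) = cip y x"
  by (simp add: cip_def mult.commute)

lemma cip_eq_0_commute: "cip x y = 0 \<longleftrightarrow> cip y x = 0"
  by (metis cip_cnj complex_cnj_zero_iff)

lemma cip_add: "cip (x + y) z = cip x z + cip y z" "cip z (x + y) = cip z x + cip z y"
  by (simp_all add: cip_def sum.distrib distrib_left distrib_right)

lemma cip_scale: "cip (c *s x) y = c * cip x y" "cip x (c *s y) = cnj c * cip x y"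
  by (simp_all add: cip_def sum_distrib_left mult_ac)

lemma cip_scaleR: "cip (r *\<^sub>R x) y = of_real r * cip x y" "cip x (r *\<^sub>R y) = of_real r * cip x y"
  unfolding cip_def sum_distrib_left vector_scaleR_component
  by (simp_all only: scaleR_conv_of_real complex_cnj_mult complex_cnj_complex_of_real mult_ac)

lemma cip_minus: "cip (- x) y = - cip x y" "cip x (- y) = - cip x y"
  by (simp_all add: cip_def sum_negf)

lemma cip_zero [simp]: "cip 0 y = 0" "cip x 0 = 0"
  by (simp_all add: cip_def)

lemma inner_eq_Re_cip: "x \<bullet> y = Re (cip x y)"
  by (simp add: cip_def inner_vec_def inner_complex_def)

lemma cip_self: "cip x x = of_real ((norm x)\<^sup>2)"
proof -
  have "Im (cip x x) = 0" by (simp add: cip_def)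
  then show ?thesis
    by (simp add: complex_eq_iff power2_norm_eq_inner inner_eq_Re_cip)
qed

lemma cip_self_eq_1: "cip x x = 1 \<longleftrightarrow> norm x = 1"
  unfolding cip_self using norm_ge_zero[of x] by (auto simp: of_real_eq_1_iff power2_eq_1_iff simp del: of_real_power norm_ge_zero)

lemma outer_mult_vec: "outer x *v y = cip y x *s x"
  by (simp add: outer_def matrix_vector_mult_def vec_eq_iff cip_def sum_distrib_left sum_distrib_right mult_ac)

lemma outer_scale: "outer (c *s x) = (cmod c)\<^sup>2 *\<^sub>R outer x"
  unfolding vec_eq_iff outer_def
  by (simp, simp add: scaleR_conv_of_real complex_norm_square mult_ac del: of_real_power)

lemma outer_minus [simp]: "outer (- x) = outer x"
  by (simp add: outer_def)

lemma self_adjointD: "X \<in> self_adjoint_matrices \<Longrightarrow> cnj (X $ j $ i) = X $ i $ j"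
  by (auto simp: self_adjoint_matrices_def map_matrix_def transpose_def vec_eq_iff)

lemma self_adjointI: "(\<And>i j. cnj (X $ j $ i) = X $ i $ j) \<Longrightarrow> X \<in> self_adjoint_matrices"
  by (auto simp: self_adjoint_matrices_def map_matrix_def transpose_def vec_eq_iff)

lemma self_adjoint_outer: "outer x \<in> self_adjoint_matrices"
  by (rule self_adjointI) (simp add: outer_def mult.commute)

lemma self_adjoint_add:
  "A \<in> self_adjoint_matrices \<Longrightarrow> B \<in> self_adjoint_matrices \<Longrightarrow> A + B \<in> self_adjoint_matrices"
  by (rule self_adjointI) (simp add: self_adjointD)

lemma self_adjoint_diff:
  "A \<in> self_adjoint_matrices \<Longrightarrow> B \<in> self_adjoint_matrices \<Longrightarrow> A - B \<in> self_adjoint_matrices"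
  by (rule self_adjointI) (simp add: self_adjointD)

lemma self_adjoint_scaleR:
  "A \<in> self_adjoint_matrices \<Longrightarrow> r *\<^sub>R A \<in> self_adjoint_matrices"
  by (rule self_adjointI) (simp add: self_adjointD)

lemma self_adjoint_sum:
  "(\<And>i. i \<in> S \<Longrightarrow> f i \<in> self_adjoint_matrices) \<Longrightarrow> (\<Sum>i\<in>S. f i) \<in> self_adjoint_matrices"
  by (induction S rule: infinite_finite_induct) (auto intro: self_adjoint_add self_adjointI)

lemma self_adjoint_spec: "spec u d \<in> self_adjoint_matrices"
  unfolding spec_def by (intro self_adjoint_sum self_adjoint_scaleR self_adjoint_outer)

lemma self_adjoint_proj: "proj B \<in> self_adjoint_matrices"
  unfolding proj_def by (intro self_adjoint_sum self_adjoint_outer)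

lemma self_adjoint_cip:
  assumes "X \<in> self_adjoint_matrices"
  shows "cip (X *v x) y = cip x (X *v y)"
proof -
  have "cip (X *v x) y = (\<Sum>i\<in>UNIV. \<Sum>j\<in>UNIV. X $ i $ j * x $ j * cnj (y $ i))"
    by (simp add: cip_def matrix_vector_mult_def sum_distrib_right)
  also have "\<dots> = (\<Sum>j\<in>UNIV. \<Sum>i\<in>UNIV. X $ i $ j * x $ j * cnj (y $ i))"
    by (rule sum.swap)
  also have "\<dots> = cip x (X *v y)"
    by (simp add: cip_def matrix_vector_mult_def sum_distrib_left self_adjointD[OF assms] mult_ac)
  finally show ?thesis .
qed

lemma exists_orthogonal_unit:
  fixes B :: "(complex^'n::finite) set"
  assumes "finite B" "card B < CARD('n)"
  shows "\<exists>v. norm v = 1 \<and> (\<forall>b\<in>B. cip v b = 0)"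
proof -
  \<comment> \<open>The space has real dimension 2n. Real orthogonality to both b and
    \<open>\<i> *s b\<close> is complex orthogonality to b, and at most \<open>2 * card B\<close>
    vectors cannot span.\<close>
  define S where "S = B \<union> (\<lambda>b. \<i> *s b) ` B"
  have "dim S \<le> card S" using assms by (intro dim_le_card') (auto simp: S_def)
  also have "\<dots> \<le> card B + card ((\<lambda>b. \<i> *s b) ` B)" unfolding S_def by (rule card_Un_le)
  also have "\<dots> \<le> card B + card B" using card_image_le[OF assms(1)] by auto
  also have "\<dots> < DIM(complex^'n)" using assms by simp
  finally obtain x where x: "x \<noteq> 0" "\<And>y. y \<in> span S \<Longrightarrow> orthogonal x y"
    using orthogonal_to_subspace_exists by blast
  have "cip x b = 0" if "b \<in> B" for b
  proof -
    have "x \<bullet> b = 0" "x \<bullet> (\<i> *s b) = 0"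
      using x(2)[of b] x(2)[of "\<i> *s b"] that by (auto simp: orthogonal_def S_def span_base)
    then show ?thesis by (simp add: inner_eq_Re_cip cip_scale complex_eq_iff)
  qed
  then show ?thesis using x(1)
    by (intro exI[of _ "(1 / norm x) *\<^sub>R x"]) (auto simp: cip_scaleR)
qed

lemma orthonormal_insert:
  assumes "orthonormal B" "norm v = 1" "\<And>b. b \<in> B \<Longrightarrow> cip v b = 0"
  shows "orthonormal (insert v B)" "v \<notin> B"
proof -
  show "v \<notin> B" using assms(2,3) by (metis cip_self_eq_1 zero_neq_one)
  then show "orthonormal (insert v B)"
    using assms by (auto simp: orthonormal_def cip_self_eq_1 cip_eq_0_commute[of _ v])
qed

lemma orthonormal_subset: "orthonormal B \<Longrightarrow> A \<subseteq> B \<Longrightarrow> orthonormal A"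
  unfolding orthonormal_def by (meson finite_subset subsetD)

lemma orthonormal_empty [simp]: "orthonormal {}"
  by (simp add: orthonormal_def)

lemma orthonormal_norm: "orthonormal B \<Longrightarrow> x \<in> B \<Longrightarrow> norm x = 1"
  unfolding orthonormal_def by (metis cip_self_eq_1)

lemma orthonormal_extend:
  fixes A :: "(complex^'n::finite) set"
  assumes "orthonormal A" "finite C" "\<And>a c. a \<in> A \<Longrightarrow> c \<in> C \<Longrightarrow> cip a c = 0"
    and "card A \<le> m" "m + card C \<le> CARD('n)"
  shows "\<exists>N. A \<subseteq> N \<and> orthonormal N \<and> card N = m \<and> (\<forall>a\<in>N. \<forall>c\<in>C. cip a c = 0)"
  using assms(4,5)
proof (induction m rule: dec_induct)
  case base
  then show ?case using assms by blast
next
  case (step m)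
  then obtain N where N: "A \<subseteq> N" "orthonormal N" "card N = m" "\<forall>a\<in>N. \<forall>c\<in>C. cip a c = 0"
    by auto
  have fin: "finite N" using N by (simp add: orthonormal_def)
  have "card (N \<union> C) < CARD('n)" using card_Un_le[of N C] N step by linarith
  then obtain v where v: "norm v = 1" "\<forall>b\<in>N \<union> C. cip v b = 0"
    using exists_orthogonal_unit[of "N \<union> C"] fin assms(2) by auto
  have "orthonormal (insert v N)" "v \<notin> N" using orthonormal_insert[of N v] N v by auto
  then show ?case using N v fin by (intro exI[of _ "insert v N"]) auto
qed

lemma orthonormal_extend_basis:
  fixes A :: "(complex^'n::finite) set"
  assumes "orthonormal A" "card A \<le> CARD('n)"
  shows "\<exists>N. A \<subseteq> N \<and> orthonormal N \<and> card N = CARD('n)"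
  using orthonormal_extend[of A "{}" "CARD('n)"] assms by auto

lemma frame_of_basis:
  fixes B :: "(complex^'n::finite) set"
  assumes "orthonormal B" "card B = CARD('n)"
  shows "\<exists>u. frame u \<and> range u = B"
proof -
  obtain u where "bij_betw u (UNIV::'n set) B"
    using finite_same_card_bij[of "UNIV::'n set" B] assms by (auto simp: orthonormal_def)
  then show ?thesis using assms
    by (intro exI[of _ u]) (auto simp: frame_def orthonormal_def bij_betw_def inj_on_def)
qed

lemma frame_inj: "frame u \<Longrightarrow> inj u"
  unfolding frame_def inj_def by (metis zero_neq_one)

lemma frame_orthonormal: "frame u \<Longrightarrow> orthonormal (u ` S)"
  using frame_inj[of u] by (auto simp: orthonormal_def frame_def dest: injD)

lemma frame_norm: "frame u \<Longrightarrow> norm (u i) = 1"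
  by (simp add: frame_def cip_self_eq_1[symmetric])

lemma frame_comp: "frame u \<Longrightarrow> inj p \<Longrightarrow> frame (u \<circ> p)"
  by (auto simp: frame_def inj_def)

lemma spec_comp:
  assumes "bij p"
  shows "spec (u \<circ> p) (\<chi> i. d $ p i) = spec u d"
proof -
  have "spec (u \<circ> p) (\<chi> i. d $ p i) = (\<Sum>i\<in>UNIV. d $ p i *\<^sub>R outer (u (p i)))"
    by (simp add: spec_def)
  also have "\<dots> = spec u d" unfolding spec_def
    using assms by (intro sum.reindex_bij_betw[where g = "\<lambda>i. d $ i *\<^sub>R outer (u i)"]) auto
  finally show ?thesis .
qed

lemma spec_indicator:
  assumes "frame u"
  shows "spec u (\<chi> i. of_bool (i \<in> S)) = proj (u ` S)"
proof -
  have "spec u (\<chi> i. of_bool (i \<in> S)) = (\<Sum>i\<in>UNIV. if i \<in> S then outer (u i) else 0)"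
    unfolding spec_def by (intro sum.cong) auto
  also have "\<dots> = (\<Sum>i\<in>S. outer (u i))" by (simp add: sum.If_cases)
  also have "\<dots> = proj (u ` S)" unfolding proj_def
    using frame_inj[OF assms] by (subst sum.reindex) (auto simp: inj_on_def inj_def)
  finally show ?thesis .
qed

lemma spec_conj:
  fixes u :: "'n::finite \<Rightarrow> complex^'n"
  assumes "frame u"
  shows "\<exists>M. invertible M \<and> (\<forall>d. spec u d = M ** diag_mat (\<lambda>i. of_real (d $ i)) ** matrix_inv M)"
proof -
  define M where "M = (\<chi> a i. u i $ a)"
  define M' where "M' = (\<chi> i a. cnj (u i $ a))"
  have "M' ** M = mat 1"
  proof -
    have "(M' ** M) $ i $ j = cip (u j) (u i)" for i j
      by (simp add: M_def M'_def matrix_matrix_mult_def cip_def mult.commute)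
    then show ?thesis using assms by (auto simp: vec_eq_iff frame_def mat_def)
  qed
  then have MM': "M ** M' = mat 1" by (simp add: matrix_left_right_inverse)
  then have inv: "invertible M" by (auto simp: invertible_right_inverse)
  have "spec u d = M ** diag_mat (\<lambda>i. of_real (d $ i)) ** M'" for d
    unfolding vec_eq_iff spec_def M_def M'_def diag_mat_def matrix_matrix_mult_def outer_def
    by (simp add: if_distrib if_distribR cong: if_cong)
      (simp add: scaleR_conv_of_real mult_ac)
  then show ?thesis using matrix_inv_unique[OF MM'] inv by metis
qed

lemma spec_one:
  assumes "frame u" shows "spec u (\<chi> i. 1) = mat 1"
  using spec_conj[OF assms] by (auto simp: diag_mat_one matrix_inv_right)

lemma proj_basis:
  assumes "frame u" shows "proj (range u) = mat 1"
  using spec_indicator[OF assms, of UNIV] spec_one[OF assms] by simp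

lemma proj_basis':
  fixes B :: "(complex^'n::finite) set"
  assumes "orthonormal B" "card B = CARD('n)"
  shows "proj B = mat 1"
  using frame_of_basis[OF assms] proj_basis by auto

lemma spectrum_spec:
  assumes "frame u" shows "spectrum (spec u d) = range (\<lambda>i. of_real (d $ i))"
  using spec_conj[OF assms] by (auto simp: spectrum_conj spectrum_diag_mat)

lemma spec_commute:
  assumes "frame u" shows "spec u d ** spec u d' = spec u d' ** spec u d"
proof -
  obtain M where "invertible M" "\<forall>d. spec u d = M ** diag_mat (\<lambda>i. of_real (d $ i)) ** matrix_inv M"
    using spec_conj[OF assms] by blast
  then show ?thesis by (simp add: conj_mult diag_mat_mult mult.commute)
qed

lemma proj_mult_vec:
  assumes "orthonormal B" "x \<in> B" shows "proj B *v x = x"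
proof -
  have "proj B *v x = (\<Sum>b\<in>B. cip x b *s b)"
    unfolding proj_def by (induction B rule: infinite_finite_induct)
      (simp_all add: matrix_vector_mult_add_rdistrib outer_mult_vec)
  also have "\<dots> = (\<Sum>b\<in>B. if x = b then x else 0)"
    using assms by (intro sum.cong) (auto simp: orthonormal_def)
  also have "\<dots> = x" using assms by (simp add: orthonormal_def sum.delta)
  finally show ?thesis .
qed

text \<open>The projection is self-adjoint and fixes every b in B, which moves it from x to b. Thus
  orthogonality to B can be read off from the matrix \<open>proj B\<close> alone, as a function of
  projections has to do.\<close>

lemma proj_mult_vec_eq_0:
  assumes "orthonormal B"
  shows "proj B *v x = 0 \<longleftrightarrow> (\<forall>b\<in>B. cip x b = 0)"
proof
  assume "proj B *v x = 0"
  then show "\<forall>b\<in>B. cip x b = 0"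
    by (metis assms cip_zero(1) proj_mult_vec self_adjoint_cip self_adjoint_proj)
next
  assume "\<forall>b\<in>B. cip x b = 0"
  then show "proj B *v x = 0"
    unfolding proj_def by (induction B rule: infinite_finite_induct)
      (simp_all add: matrix_vector_mult_add_rdistrib outer_mult_vec)
qed

lemma proj_insert:
  "orthonormal B \<Longrightarrow> v \<notin> B \<Longrightarrow> proj (insert v B) = proj B + outer v"
  by (simp add: proj_def orthonormal_def add.commute)

section \<open>Sorted spectral decompositions\<close>

definition rank_of :: "'n::{finite,linorder} \<Rightarrow> nat" where
  "rank_of i = card {k. k < i}"

definition increasing :: "real^'n::{finite,linorder} \<Rightarrow> bool" where
  "increasing d \<longleftrightarrow> (\<forall>i j. i \<le> j \<longrightarrow> d $ i \<le> d $ j)"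

lemma rank_of_less: "i < j \<Longrightarrow> rank_of i < rank_of j"
  unfolding rank_of_def by (rule psubset_card_mono) auto

lemma rank_of_bij: "bij_betw rank_of (UNIV :: 'n::{finite,linorder} set) {..<CARD('n)}"
proof -
  have inj: "inj (rank_of :: 'n \<Rightarrow> nat)"
    by (rule linorder_injI) (metis rank_of_less nat_neq_iff)
  have "rank_of i < CARD('n)" for i :: 'n
    unfolding rank_of_def by (rule psubset_card_mono) auto
  then have "range (rank_of :: 'n \<Rightarrow> nat) \<subseteq> {..<CARD('n)}" by auto
  moreover have "card (range (rank_of :: 'n \<Rightarrow> nat)) = CARD('n)" by (simp add: card_image inj)
  ultimately show ?thesis using inj by (simp add: bij_betw_def card_subset_eq)
qed

lemma exists_sorting:
  fixes d :: "'n::{finite,linorder} \<Rightarrow> real"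
  shows "\<exists>p :: 'n \<Rightarrow> 'n. bij p \<and> (\<forall>i j. i \<le> j \<longrightarrow> d (p i) \<le> d (p j))"
proof -
  define ys where "ys = sort_key d (sorted_list_of_set (UNIV :: 'n set))"
  have ys: "distinct ys" "set ys = UNIV" "length ys = CARD('n)" "sorted (map d ys)"
    by (simp_all add: ys_def)
  define p :: "'n \<Rightarrow> 'n" where "p = (!) ys \<circ> rank_of"
  have "bij_betw ((!) ys) {..<CARD('n)} UNIV" using ys by (intro bij_betw_nth) auto
  then have "bij p" unfolding p_def by (rule bij_betw_trans[OF rank_of_bij])
  moreover have "d (p i) \<le> d (p j)" if "i \<le> j" for i j
  proof -
    have "rank_of i \<le> rank_of j" using that rank_of_less by (metis less_or_eq_imp_le order_le_less)
    moreover have "rank_of j < length ys" using bij_betwE[OF rank_of_bij] ys(3) by auto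
    ultimately show ?thesis using sorted_nth_mono[OF ys(4), of "rank_of i" "rank_of j"]
      by (simp add: p_def)
  qed
  ultimately show ?thesis by (intro exI[of _ p]) auto
qed

lemma sorted_list_nth_rank_of:
  "sorted_list_of_set (UNIV :: 'n::{finite,linorder} set) ! rank_of i = i"
proof -
  define xs where "xs = sorted_list_of_set (UNIV :: 'n set)"
  have xs: "sorted_wrt (<) xs" "set xs = UNIV" "distinct xs" by (simp_all add: xs_def)
  then obtain p where p: "p < length xs" "i = xs ! p" by (metis UNIV_I in_set_conv_nth)
  have "{k. k < i} = (!) xs ` {..<p}"
  proof (intro equalityI subsetI)
    fix k assume "k \<in> {k. k < i}"
    obtain q where q: "q < length xs" "k = xs ! q" using xs by (metis UNIV_I in_set_conv_nth)
    have "q < p"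
    proof (rule ccontr)
      assume "\<not> q < p"
      then have "xs ! p \<le> xs ! q"
        by (metis le_less not_less sorted_wrt_nth_less[OF xs(1)] q(1) less_imp_le order_refl)
      then show False using \<open>k \<in> {k. k < i}\<close> p q by simp
    qed
    then show "k \<in> (!) xs ` {..<p}" using q by auto
  qed (use sorted_wrt_nth_less[OF xs(1)] p in auto)
  then have "rank_of i = card ((!) xs ` {..<p})" by (simp add: rank_of_def)
  also have "\<dots> = p" using xs(3) p by (subst card_image) (auto simp: inj_on_def nth_eq_iff_index_eq)
  finally show ?thesis using p by (simp add: xs_def)
qed

section \<open>Spectral theorem through maxima of the quadratic form\<close>

lemma continuous_on_matrix_vector_mult:
  "continuous_on S f \<Longrightarrow> continuous_on S (\<lambda>x. (X :: 'n::finite cmatrix) *v f x)"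
  unfolding matrix_vector_mult_def
  by (intro continuous_on_vec_lambda continuous_on_sum continuous_on_mult continuous_on_const
      continuous_on_component)

lemma matrix_vector_scaleR: "(X :: 'n::finite cmatrix) *v (r *\<^sub>R w) = r *\<^sub>R (X *v w)"
  by (simp add: matrix_vector_mult_def vec_eq_iff scaleR_sum_right)

text \<open>Maximize the quadratic form of X on the unit sphere of the orthogonal complement of B.
  This complement is invariant, because X is self-adjoint and the elements of B are eigenvectors, so
  a maximizer is an eigenvector.\<close>

lemma hermitian_eigenvector:
  fixes X :: "'n::finite cmatrix"
  assumes X: "X \<in> self_adjoint_matrices" and B: "finite B" "card B < CARD('n)"
    and eig: "\<And>b. b \<in> B \<Longrightarrow> \<exists>c. X *v b = c *s b"
  shows "\<exists>v r. norm v = 1 \<and> (\<forall>b\<in>B. cip v b = 0) \<and> X *v v = r *\<^sub>R v"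
proof -
  define W where "W = {v. \<forall>b\<in>B. cip v b = 0}"
  define K where "K = sphere 0 1 \<inter> W"
  have "closed W" unfolding W_def cip_def Ball_def
    by (intro closed_Collect_all closed_Collect_imp open_Collect_const closed_Collect_eq
        continuous_intros continuous_on_component)
  then have "compact K" unfolding K_def by (intro compact_Int_closed) auto
  moreover have "K \<noteq> {}" using exists_orthogonal_unit[OF B] by (auto simp: K_def W_def)
  moreover have "continuous_on K (\<lambda>v. (X *v v) \<bullet> v)"
    by (intro continuous_on_inner continuous_on_matrix_vector_mult continuous_on_id)
  ultimately have "\<exists>v\<in>K. \<forall>w\<in>K. (X *v w) \<bullet> w \<le> (X *v v) \<bullet> v"
    by (rule continuous_attains_sup)
  then obtain v where v: "v \<in> K" "\<And>w. w \<in> K \<Longrightarrow> (X *v w) \<bullet> w \<le> (X *v v) \<bullet> v"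
    by auto
  define r where "r = (X *v v) \<bullet> v"
  have nv: "norm v = 1" and vW: "v \<in> W" using v(1) by (auto simp: K_def)
  \<comment> \<open>The form of r - X: positive semidefinite on W by maximality of r and zero at v,
    hence v is in its kernel on W.\<close>
  define G where "G x y = r * (x \<bullet> y) - (X *v x) \<bullet> y" for x y
  have sym: "(X *v x) \<bullet> y = (X *v y) \<bullet> x" for x y
    by (metis X inner_commute inner_eq_Re_cip self_adjoint_cip)
  have G_nonneg: "0 \<le> G w w" if "w \<in> W" for w
  proof (cases "w = 0")
    case False
    then have "(1 / norm w) *\<^sub>R w \<in> K" using that by (auto simp: K_def W_def cip_scaleR)
    from v(2)[OF this] have "((X *v w) \<bullet> w) / (norm w)\<^sup>2 \<le> r"
      by (simp add: r_def matrix_vector_scaleR power2_eq_square)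
    then show ?thesis using False by (simp add: G_def divide_le_eq power2_norm_eq_inner)
  qed (simp add: G_def)
  have G0: "G v v = 0" using nv by (simp add: G_def r_def power2_norm_eq_inner[symmetric])
  have "G v y = 0" if "y \<in> W" for y
  proof (rule ccontr)
    assume nz: "G v y \<noteq> 0"
    define \<alpha> \<beta> where "\<alpha> = G v y" and "\<beta> = G y y"
    have \<beta>: "\<beta> \<ge> 0" using G_nonneg[OF that] by (simp add: \<beta>_def)
    \<comment> \<open>Close to the minimizer of
      \<open>2 * t * \<alpha> + t\<^sup>2 * \<beta>\<close>; the summand 1 keeps the denominator
      positive when \<beta> = 0.\<close>
    define t where "t = - \<alpha> / (\<beta> + 1)"
    have "v + t *\<^sub>R y \<in> W" using vW that by (auto simp: W_def cip_add cip_scaleR)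
    from G_nonneg[OF this] have "0 \<le> G v v + 2 * t * \<alpha> + t\<^sup>2 * \<beta>"
      using sym[of y v]
      by (simp add: G_def \<alpha>_def \<beta>_def matrix_vector_right_distrib matrix_vector_scaleR
          inner_add_left inner_add_right inner_commute power2_eq_square algebra_simps)
    also have "\<dots> = - (\<alpha>\<^sup>2 * (\<beta> + 2)) / (\<beta> + 1)\<^sup>2"
      using \<beta> by (simp add: G0 t_def divide_simps power2_eq_square) (simp add: algebra_simps)
    also have "\<dots> < 0" using \<beta> nz by (simp add: \<alpha>_def divide_neg_pos)
    finally show False by simp
  qed
  moreover have "r *\<^sub>R v - X *v v \<in> W"
  proof -
    have "cip (X *v v) b = 0" if "b \<in> B" for b
    proof -
      obtain c where "X *v b = c *s b" using eig[of b] \<open>b \<in> B\<close> by blast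
      then show ?thesis using that vW by (simp add: self_adjoint_cip[OF X] cip_scale W_def)
    qed
    then show ?thesis using vW by (auto simp: W_def cip_add cip_scaleR cip_minus diff_conv_add_uminus
          simp del: add_uminus_conv_diff)
  qed
  ultimately have "G v (r *\<^sub>R v - X *v v) = 0" by blast
  then have "(r *\<^sub>R v - X *v v) \<bullet> (r *\<^sub>R v - X *v v) = 0"
    by (simp add: G_def inner_diff_left)
  then have "X *v v = r *\<^sub>R v" by simp
  then show ?thesis using nv vW by (auto simp: W_def)
qed

lemma matrix_mult_outer: "X *v v = r *\<^sub>R v \<Longrightarrow> X ** outer v = r *\<^sub>R outer v"
proof -
  assume "X *v v = r *\<^sub>R v"
  then have "(X *v v) $ i * cnj (v $ j) = (r *\<^sub>R v) $ i * cnj (v $ j)" for i j by simp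
  then show ?thesis
    by (simp add: vec_eq_iff outer_def matrix_matrix_mult_def matrix_vector_mult_def
        sum_distrib_right mult.assoc)
qed

lemma spectral_theorem:
  fixes X :: "'n::{finite,linorder} cmatrix"
  assumes X: "X \<in> self_adjoint_matrices"
  shows "\<exists>u d. frame u \<and> increasing d \<and> X = spec u d"
proof -
  have "m \<le> CARD('n) \<Longrightarrow> \<exists>B. orthonormal B \<and> card B = m \<and> (\<forall>b\<in>B. \<exists>r. X *v b = r *\<^sub>R b)" for m
  proof (induction m)
    case 0
    show ?case by (intro exI[of _ "{}"]) auto
  next
    case (Suc m)
    then obtain B where B: "orthonormal B" "card B = m" "\<forall>b\<in>B. \<exists>r. X *v b = r *\<^sub>R b" by auto
    have fin: "finite B" using B by (simp add: orthonormal_def)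
    have "\<exists>c. X *v b = c *s b" if "b \<in> B" for b
    proof -
      obtain r where "X *v b = r *\<^sub>R b" using B(3) \<open>b \<in> B\<close> by auto
      then have "X *v b = of_real r *s b" by (simp add: vec_eq_iff scaleR_conv_of_real[where 'a=complex])
      then show ?thesis by blast
    qed
    then obtain v r where v: "norm v = 1" "\<forall>b\<in>B. cip v b = 0" "X *v v = r *\<^sub>R v"
      using hermitian_eigenvector[OF X fin] B Suc.prems by auto
    then have "orthonormal (insert v B)" "v \<notin> B" using orthonormal_insert[of B v] B by auto
    then show ?case using B v fin by (intro exI[of _ "insert v B"]) auto
  qed
  then obtain B where B: "orthonormal B" "card B = CARD('n)" "\<forall>b\<in>B. \<exists>r. X *v b = r *\<^sub>R b"
    by blast
  then obtain u where u: "frame u" "range u = B" using frame_of_basis by blast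
  then have "\<forall>i. \<exists>r. X *v u i = r *\<^sub>R u i" using B(3) by auto
  then obtain d where d: "\<And>i. X *v u i = d i *\<^sub>R u i" by metis
  have "X = X ** spec u (\<chi> i. 1)" using spec_one[OF u(1)] by simp
  also have "\<dots> = spec u (\<chi> i. d i)"
    by (simp add: spec_def matrix_mult_sum matrix_mult_outer[OF d])
  finally have X: "X = spec u (\<chi> i. d i)" .
  obtain p :: "'n \<Rightarrow> 'n" where p: "bij p" "\<And>i j. i \<le> j \<Longrightarrow> d (p i) \<le> d (p j)"
    using exists_sorting[of d] by auto
  have "X = spec (u \<circ> p) (\<chi> i. d (p i))"
    using spec_comp[OF p(1), of u "\<chi> i. d i"] X by simp
  moreover have "frame (u \<circ> p)" by (rule frame_comp[OF u(1) bij_is_inj[OF p(1)]])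
  moreover have "increasing (\<chi> i. d (p i))" using p(2) by (simp add: increasing_def)
  ultimately show ?thesis by blast
qed

section \<open>Sorted eigenvalues and their continuity\<close>

lemma charpoly_conj:
  fixes T :: "'n::finite cmatrix"
  assumes "invertible T"
  shows "charpoly (T ** A ** matrix_inv T) = charpoly A"
proof -
  \<comment> \<open>Constant matrices embed multiplicatively into polynomial matrices and the scalar
    matrix \<open>?x\<close> commutes with them, so the characteristic matrix itself is
    conjugated.\<close>
  let ?L = "map_matrix (\<lambda>c. [:c:]) :: 'n cmatrix \<Rightarrow> complex poly^'n^'n"
  let ?x = "mat [:0, 1:] :: complex poly^'n^'n"
  have const_sum: "[:\<Sum>i\<in>S. f i:] = (\<Sum>i\<in>S. [:f i:])" for f :: "'n \<Rightarrow> complex" and S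
    by (rule poly_eqI) (simp add: coeff_sum coeff_pCons split: nat.split)
  have L_mult: "?L (A ** B) = ?L A ** ?L B" for A B
    by (simp add: map_matrix_def matrix_matrix_mult_def vec_eq_iff const_sum mult.commute)
  have L_one: "?L (mat 1) = mat 1"
    by (simp add: map_matrix_def mat_def vec_eq_iff one_pCons)
  have comm: "?L T ** ?x = ?x ** ?L T"
    by (simp add: mat_def matrix_matrix_mult_def vec_eq_iff if_distrib if_distribR mult.commute cong: if_cong)
  have inv: "?L T ** ?L (matrix_inv T) = mat 1"
    using L_mult[of T "matrix_inv T"] by (simp add: matrix_inv_right[OF assms] L_one)
  have diff: "P ** (Q - R) ** S = P ** Q ** S - P ** R ** S" for P Q R S :: "complex poly^'n^'n"
    by (simp add: matrix_matrix_mult_def vec_eq_iff sum_subtractf left_diff_distrib right_diff_distrib)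
  have "?L T ** (?x - ?L A) ** ?L (matrix_inv T)
      = ?L T ** ?x ** ?L (matrix_inv T) - ?L (T ** A ** matrix_inv T)"
    by (simp only: L_mult diff)
  also have "?L T ** ?x ** ?L (matrix_inv T) = ?x"
    by (simp add: comm matrix_mul_assoc[symmetric] inv)
  finally have "charpoly (T ** A ** matrix_inv T) = det (?L T ** (?x - ?L A) ** ?L (matrix_inv T))"
    by (simp add: charpoly_def)
  also have "\<dots> = det (?x - ?L A) * (det (?L T) * det (?L (matrix_inv T)))"
    by (simp add: det_mul mult_ac)
  also have "det (?L T) * det (?L (matrix_inv T)) = 1" by (simp add: det_mul[symmetric] inv)
  finally show ?thesis by (simp add: charpoly_def)
qed

lemma charpoly_diag_mat: "charpoly (diag_mat a) = (\<Prod>i\<in>UNIV. [:- a i, 1:])"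
  unfolding charpoly_def
  by (subst det_diagonal) (simp_all add: diag_mat_def mat_def map_matrix_def)

lemma sorted_eigenvalues_spec:
  fixes u :: "'n::{finite,linorder} \<Rightarrow> (complex, 'n) vec"
  assumes u: "frame u" and d: "increasing d"
  shows "sorted_eigenvalues (spec u d) = map (($) d) (sorted_list_of_set UNIV)"
proof -
  let ?xs = "sorted_list_of_set (UNIV :: 'n set)"
  obtain M where M: "invertible M" "spec u d = M ** diag_mat (\<lambda>i. of_real (d $ i)) ** matrix_inv M"
    using spec_conj[OF u] by blast
  have "proots (charpoly (spec u d)) = (\<Sum>i\<in>UNIV. {#complex_of_real (d $ i)#})"
    by (simp add: M charpoly_conj charpoly_diag_mat proots_prod proots_linear_factor)
  also have "\<dots> = image_mset (\<lambda>i. complex_of_real (d $ i)) (mset_set UNIV)"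
    by (simp add: sum_unfold_sum_mset)
  finally have "image_mset Re (proots (charpoly (spec u d))) = image_mset (($) d) (mset_set UNIV)"
    by (simp add: image_mset.compositionality comp_def)
  also have "mset_set (UNIV :: 'n set) = mset ?xs"
    using mset_set_set[of ?xs] by simp
  also have "image_mset (($) d) (mset ?xs) = mset (map (($) d) ?xs)" by simp
  finally have "sorted_eigenvalues (spec u d) = sort (map (($) d) ?xs)"
    by (simp only: sorted_eigenvalues_def sorted_list_of_multiset_mset)
  moreover have "sorted (map (($) d) ?xs)"
    unfolding sorted_map
    by (rule sorted_wrt_mono_rel[OF _ sorted_sorted_list_of_set]) (use d in \<open>auto simp: increasing_def\<close>)
  ultimately show ?thesis by (simp add: sorted_sort_id)
qed

definition eigenvalue_vec :: "'n::{finite,linorder} cmatrix \<Rightarrow> (real, 'n) vec" where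
  "eigenvalue_vec X = (\<chi> i. sorted_eigenvalues X ! rank_of i)"

lemma eigenvalue_vec_spec:
  fixes u :: "'n::{finite,linorder} \<Rightarrow> (complex, 'n) vec"
  assumes "frame u" "increasing d"
  shows "eigenvalue_vec (spec u d) = d"
proof -
  have "rank_of i < CARD('n)" for i :: 'n using bij_betwE[OF rank_of_bij] by auto
  then show ?thesis
    by (simp add: eigenvalue_vec_def sorted_eigenvalues_spec[OF assms] vec_eq_iff sorted_list_nth_rank_of)
qed

lemma sorted_eigenvalue_diag_eq:
  "sorted_eigenvalue_diag X = diag_mat (\<lambda>i. of_real (eigenvalue_vec X $ i))"
  by (simp add: sorted_eigenvalue_diag_def diag_mat_def eigenvalue_vec_def rank_of_def)

text \<open>Both squared norms are the trace of the squared matrix. The equality bounds d in the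
  compactness argument for \<open>continuous_on_eigenvalue_vec\<close>.\<close>

lemma norm_spec:
  assumes "frame u" shows "norm (spec u d) = norm d"
proof -
  obtain M where M: "invertible M" "spec u d = M ** diag_mat (\<lambda>i. of_real (d $ i)) ** matrix_inv M"
    using spec_conj[OF assms] by blast
  let ?X = "spec u d"
  have "of_real ((norm ?X)\<^sup>2) = trace (?X ** ?X)"
  proof -
    have "trace (?X ** ?X) = (\<Sum>i\<in>UNIV. \<Sum>j\<in>UNIV. ?X $ i $ j * cnj (?X $ i $ j))"
      using self_adjointD[OF self_adjoint_spec, of u d]
      by (simp add: trace_def matrix_matrix_mult_def)
    also have "\<dots> = of_real (\<Sum>i\<in>UNIV. \<Sum>j\<in>UNIV. (cmod (?X $ i $ j))\<^sup>2)"
      by (simp add: complex_norm_square del: of_real_power)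
    also have "(\<Sum>i\<in>UNIV. \<Sum>j\<in>UNIV. (cmod (?X $ i $ j))\<^sup>2) = (norm ?X)\<^sup>2"
      by (simp only: power2_norm_eq_inner inner_vec_def)
    finally show ?thesis by simp
  qed
  also have "\<dots> = trace (diag_mat (\<lambda>i. of_real (d $ i) * of_real (d $ i)))"
    by (simp only: M(2) conj_mult[OF M(1)] diag_mat_mult trace_conj[OF M(1)])
  also have "\<dots> = of_real ((norm d)\<^sup>2)"
    by (simp add: trace_diag_mat power2_norm_eq_inner inner_vec_def)
  finally have "(norm ?X)\<^sup>2 = (norm d)\<^sup>2" using of_real_eq_iff by blast
  then show ?thesis by simp
qed

lemma continuous_on_outer [continuous_intros]:
  "continuous_on S f \<Longrightarrow> continuous_on S (\<lambda>x. outer (f x))"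
  unfolding outer_def
  by (intro continuous_intros continuous_on_vec_lambda continuous_on_component)

lemma continuous_on_matrix_mult [continuous_intros]:
  fixes f g :: "'a::topological_space \<Rightarrow> 'n::finite cmatrix"
  shows "continuous_on S f \<Longrightarrow> continuous_on S g \<Longrightarrow> continuous_on S (\<lambda>x. f x ** g x)"
  unfolding matrix_matrix_mult_def
  by (intro continuous_intros continuous_on_vec_lambda continuous_on_component)

lemma closed_self_adjoint: "closed (self_adjoint_matrices :: 'n::finite cmatrix set)"
proof -
  have "self_adjoint_matrices = {X :: 'n cmatrix. \<forall>i j. cnj (X $ j $ i) = X $ i $ j}"
    by (auto intro: self_adjointI self_adjointD)
  also have "closed \<dots>"
    by (intro closed_Collect_all closed_Collect_eq continuous_intros continuous_on_component)
  finally show ?thesis .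
qed

lemma compact_frames: "compact {U :: complex^'n^'n. frame (($) U)}"
proof -
  have "closed {U :: complex^'n^'n. frame (($) U)}"
    unfolding frame_def cip_def
    by (intro closed_Collect_all closed_Collect_eq continuous_intros continuous_on_component)
  moreover have "norm U \<le> of_nat CARD('n)" if "frame (($) U)" for U :: "complex^'n^'n"
  proof -
    have "norm U \<le> (\<Sum>i\<in>UNIV. norm (U $ i))" unfolding norm_vec_def by (rule L2_set_le_sum) simp
    then show ?thesis by (simp add: frame_norm[OF that])
  qed
  then have "bounded {U :: complex^'n^'n. frame (($) U)}" by (auto simp: bounded_iff)
  ultimately show ?thesis by (simp add: compact_eq_bounded_closed)
qed

text \<open>Compactness takes the place of perturbation estimates. A convergent sequence whose
  eigenvalue vectors lie in a closed set B is bounded, so it stays in the image under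
  \<open>spec\<close> of a compact set of frames and increasing vectors of B; this image is closed
  and contains the limit.\<close>

lemma continuous_on_eigenvalue_vec:
  "continuous_on self_adjoint_matrices (eigenvalue_vec :: 'n::{finite,linorder} cmatrix \<Rightarrow> _)"
proof -
  have "closed (eigenvalue_vec -` B \<inter> self_adjoint_matrices :: 'n cmatrix set)"
    (is "closed ?S") if B: "closed B" for B
    unfolding closed_sequential_limits
  proof (intro allI impI, elim conjE)
    fix x :: "nat \<Rightarrow> 'n cmatrix" and l
    assume x: "\<forall>n. x n \<in> ?S" and lim: "x \<longlonglongrightarrow> l"
    obtain R where R: "\<And>n. norm (x n) \<le> R"
      using convergent_imp_bounded[OF lim] by (auto simp: bounded_iff)
    let ?D = "{d :: (real, 'n) vec. increasing d} \<inter> B \<inter> cball 0 R"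
    let ?spec = "\<lambda>(U :: 'n cmatrix, d). spec (($) U) d"
    have "closed {d :: (real, 'n) vec. increasing d}" unfolding increasing_def
      by (intro closed_Collect_all closed_Collect_imp open_Collect_const closed_Collect_le
          continuous_intros continuous_on_component)
    then have "compact ?D" using B by (intro closed_Int_compact closed_Int) auto
    then have "compact ({U :: 'n cmatrix. frame (($) U)} \<times> ?D)"
      by (rule compact_Times[OF compact_frames])
    moreover have "continuous_on A ?spec" for A
      unfolding spec_def split_def by (intro continuous_intros continuous_on_component)
    ultimately have "compact (?spec ` ({U. frame (($) U)} \<times> ?D))"
      by (intro compact_continuous_image)
    moreover have "x n \<in> ?spec ` ({U. frame (($) U)} \<times> ?D)" for n
    proof -
      obtain u d where ud: "frame u" "increasing d" "x n = spec u d"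
        using spectral_theorem[of "x n"] x by auto
      have "eigenvalue_vec (x n) \<in> B" using x by auto
      then have "d \<in> ?D" using R[of n] ud by (simp add: eigenvalue_vec_spec norm_spec)
      moreover have "($) (\<chi> i. u i) = u" by auto
      ultimately show ?thesis using ud by (intro image_eqI[of _ _ "(\<chi> i. u i, d)"]) auto
    qed
    ultimately have "l \<in> ?spec ` ({U. frame (($) U)} \<times> ?D)"
      using closed_sequentially[OF compact_imp_closed _ lim] by blast
    then obtain U d where "frame (($) U)" "d \<in> ?D" "l = spec (($) U) d" by auto
    then show "l \<in> ?S" by (simp add: self_adjoint_spec eigenvalue_vec_spec)
  qed
  then show ?thesis by (simp add: continuous_on_closed_vimage[OF closed_self_adjoint])
qed

section \<open>The maps of the classification are CS-preserving\<close>

lemma continuous_on_transpose: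
  "continuous_on S (transpose :: 'n::finite cmatrix \<Rightarrow> _)"
  unfolding transpose_def by (intro continuous_on_vec_lambda continuous_on_component continuous_on_id)

lemma spectrum_transpose:
  assumes "X \<in> self_adjoint_matrices"
  shows "spectrum (transpose X) = spectrum (X :: 'n::{finite,linorder} cmatrix)"
proof -
  obtain u d where ud: "frame u" "X = spec u d" using spectral_theorem[OF assms] by blast
  define w where "w i = (\<chi> k. cnj (u i $ k))" for i
  have "cip (w i) (w j) = cip (u j) (u i)" for i j by (simp add: cip_def w_def mult.commute)
  then have "frame w" using ud(1) by (auto simp: frame_def)
  moreover have "transpose X = spec w d"
    by (simp add: ud spec_def transpose_def vec_eq_iff outer_def w_def mult.commute)
  ultimately show ?thesis using ud by (simp add: spectrum_spec)
qed

lemma classified_imp_CS_preserving: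
  fixes \<phi> \<psi> :: "'n::{finite,linorder} cmatrix \<Rightarrow> 'n cmatrix"
  assumes T: "invertible T"
    and \<phi>: "\<And>X. X \<in> self_adjoint_matrices \<Longrightarrow> \<phi> X = T ** \<psi> X ** matrix_inv T"
    and cont: "continuous_on self_adjoint_matrices \<psi>"
    and CS: "CS_preserving_on self_adjoint_matrices \<psi>"
  shows "continuous_on self_adjoint_matrices \<phi> \<and> CS_preserving_on self_adjoint_matrices \<phi>"
proof
  have "continuous_on self_adjoint_matrices (\<lambda>X. T ** \<psi> X ** matrix_inv T)"
    by (intro continuous_intros cont)
  then show "continuous_on self_adjoint_matrices \<phi>" by (simp add: \<phi> cong: continuous_on_cong)
  show "CS_preserving_on self_adjoint_matrices \<phi>"
    using CS unfolding CS_preserving_on_def commutativity_preserving_on_def spectrum_preserving_on_def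
    by (simp add: \<phi> conj_mult[OF T] spectrum_conj[OF T])
qed

lemma CS_preserving_id: "CS_preserving_on S (\<lambda>X. X)"
  by (simp add: CS_preserving_on_def commutativity_preserving_on_def spectrum_preserving_on_def)

lemma CS_preserving_transpose:
  "CS_preserving_on self_adjoint_matrices (transpose :: 'n::{finite,linorder} cmatrix \<Rightarrow> _)"
  by (simp add: CS_preserving_on_def commutativity_preserving_on_def spectrum_preserving_on_def
      spectrum_transpose matrix_transpose_mul[symmetric])

lemma continuous_on_sorted_eigenvalue_diag:
  "continuous_on self_adjoint_matrices (sorted_eigenvalue_diag :: 'n::{finite,linorder} cmatrix \<Rightarrow> _)"
proof -
  have "continuous_on self_adjoint_matrices
      (\<lambda>X :: 'n cmatrix. if i = j then complex_of_real (eigenvalue_vec X $ i) else 0)" for i j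
    by (cases "i = j") (auto intro!: continuous_intros continuous_on_component continuous_on_eigenvalue_vec)
  then show ?thesis unfolding sorted_eigenvalue_diag_eq diag_mat_def
    by (intro continuous_on_vec_lambda)
qed

lemma CS_preserving_sorted_eigenvalue_diag:
  "CS_preserving_on self_adjoint_matrices (sorted_eigenvalue_diag :: 'n::{finite,linorder} cmatrix \<Rightarrow> _)"
proof -
  have "spectrum (sorted_eigenvalue_diag X) = spectrum X" if "X \<in> self_adjoint_matrices"
    for X :: "'n cmatrix"
    using spectral_theorem[OF that]
    by (auto simp: sorted_eigenvalue_diag_eq eigenvalue_vec_spec spectrum_spec spectrum_diag_mat)
  then show ?thesis
    by (simp add: CS_preserving_on_def commutativity_preserving_on_def spectrum_preserving_on_def
        sorted_eigenvalue_diag_eq diag_mat_mult mult.commute)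
qed

section \<open>Restriction of a CS-preserving map to a maximal commutative family\<close>

text \<open>For invertible T, the idempotent onto the columns of T indexed by S, along the other
  columns. With T fixed, products become intersections and traces become cardinalities, so images of
  projections can be handled as index sets.\<close>

definition cproj :: "'n::finite cmatrix \<Rightarrow> 'n set \<Rightarrow> 'n cmatrix" where
  "cproj T S = T ** diag_mat (\<lambda>i. of_bool (i \<in> S)) ** matrix_inv T"

lemma trace_cproj: "invertible T \<Longrightarrow> trace (cproj T S) = of_nat (card S)"
  by (simp add: cproj_def trace_conj trace_diag_mat)

lemma cproj_mult: "invertible T \<Longrightarrow> cproj T S ** cproj T S' = cproj T (S \<inter> S')"
  by (simp add: cproj_def conj_mult diag_mat_mult of_bool_conj)

lemma cproj_inject: "invertible T \<Longrightarrow> cproj T S = cproj T S' \<longleftrightarrow> S = S'"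
  by (auto simp: cproj_def conj_inject diag_mat_inject fun_eq_iff)

lemma cproj_union:
  assumes "S \<inter> S' = {}" shows "cproj T (S \<union> S') = cproj T S + cproj T S'"
proof -
  have "diag_mat (\<lambda>i. of_bool (i \<in> S \<union> S'))
      = diag_mat (\<lambda>i. of_bool (i \<in> S)) + diag_mat (\<lambda>i. of_bool (i \<in> S'))"
    using assms by (auto simp: diag_mat_def vec_eq_iff)
  then show ?thesis by (simp add: cproj_def matrix_add_ldistrib matrix_add_rdistrib')
qed

locale CS_map =
  fixes \<phi> :: "'n::{finite,linorder} cmatrix \<Rightarrow> 'n cmatrix"
  assumes cont: "continuous_on self_adjoint_matrices \<phi>"
    and CS: "CS_preserving_on self_adjoint_matrices \<phi>"
begin

lemma commute:
  "X \<in> self_adjoint_matrices \<Longrightarrow> Y \<in> self_adjoint_matrices \<Longrightarrow> X ** Y = Y ** X \<Longrightarrow>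
    \<phi> X ** \<phi> Y = \<phi> Y ** \<phi> X"
  using CS by (simp add: CS_preserving_on_def commutativity_preserving_on_def)

lemma spectrum: "X \<in> self_adjoint_matrices \<Longrightarrow> spectrum (\<phi> X) = spectrum X"
  using CS by (simp add: CS_preserving_on_def spectrum_preserving_on_def)

text \<open>On the connected chamber of strictly increasing \<open>d\<close> the eigenvalues of \<open>\<phi> (spec u d)\<close> cannot
  change places; elsewhere \<open>\<delta> d\<close> may permute them or change multiplicities.\<close>

lemma frame_diagonalization:
  assumes u: "frame u"
  shows "\<exists>T \<delta>. invertible T \<and> (\<forall>d. \<phi> (spec u d) = T ** diag_mat (\<delta> d) ** matrix_inv T)
    \<and> (\<forall>d. range (\<delta> d) = range (\<lambda>i. of_real (d $ i)))
    \<and> (\<forall>d. increasing d \<longrightarrow> \<delta> d = (\<lambda>i. of_real (d $ i)))"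
proof -
  \<comment> \<open>A base point with pairwise distinct eigenvalues: its image is diagonalizable,
    and everything commuting with that image is diagonal in the same basis.\<close>
  define d0 :: "(real, 'n) vec" where "d0 = (\<chi> i. real (rank_of i))"
  define a where "a i = complex_of_real (d0 $ i)" for i
  have less_d0: "d0 $ i < d0 $ j" if "i < j" for i j
    using rank_of_less[OF that] by (simp add: d0_def)
  have inj_a: "inj a"
    by (rule linorder_injI) (metis a_def less_d0 of_real_eq_iff less_irrefl)
  have "spectrum (\<phi> (spec u d0)) = range a"
    by (simp add: spectrum self_adjoint_spec spectrum_spec[OF u] a_def[abs_def])
  then have "\<exists>v. v \<noteq> 0 \<and> \<phi> (spec u d0) *v v = a i *s v" for i
    unfolding spectrum_def set_eq_iff mem_Collect_eq by (metis rangeI)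
  then obtain w where w: "\<And>i. w i \<noteq> 0" "\<And>i. \<phi> (spec u d0) *v w i = a i *s w i"
    by metis
  obtain T where T: "invertible T" and T0: "\<phi> (spec u d0) = T ** diag_mat a ** matrix_inv T"
    using invertible_of_eigenvectors[of "\<phi> (spec u d0)" w a] w inj_a by auto
  define M where "M d = matrix_inv T ** \<phi> (spec u d) ** T" for d
  define \<delta> where "\<delta> d i = M d $ i $ i" for d i
  have TM: "\<phi> (spec u d) = T ** M d ** matrix_inv T" for d
    by (simp add: M_def conj_cancel(2)[OF T])
  have M0: "M d0 = diag_mat a" by (simp add: M_def T0 conj_cancel(1)[OF T])
  have M_diag: "M d = diag_mat (\<delta> d)" for d
  proof -
    have "\<phi> (spec u d) ** \<phi> (spec u d0) = \<phi> (spec u d0) ** \<phi> (spec u d)"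
      by (intro commute self_adjoint_spec spec_commute u)
    then have "T ** (M d ** diag_mat a) ** matrix_inv T = T ** (diag_mat a ** M d) ** matrix_inv T"
      by (simp only: TM conj_mult[OF T] M0)
    then have "M d ** diag_mat a = diag_mat a ** M d" by (simp only: conj_inject[OF T])
    from commute_diag_mat_imp_diag[OF this inj_a] show ?thesis by (simp add: \<delta>_def[abs_def])
  qed
  have rep: "\<phi> (spec u d) = T ** diag_mat (\<delta> d) ** matrix_inv T" for d
    using TM M_diag by simp
  have range_\<delta>: "range (\<delta> d) = range (\<lambda>i. of_real (d $ i))" for d
    using spectrum[OF self_adjoint_spec, of u d]
    by (simp add: rep spectrum_conj[OF T] spectrum_diag_mat spectrum_spec[OF u])
  have \<delta>_d0: "\<delta> d0 = a"
    using T0 rep[of d0] by (simp add: conj_inject[OF T] diag_mat_inject)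
  have cont_\<delta>: "continuous_on A (\<lambda>d. \<delta> d i)" for A i
  proof -
    have "continuous_on A (spec u)"
      unfolding spec_def by (intro continuous_intros continuous_on_component)
    then have "continuous_on A (\<lambda>d. \<phi> (spec u d))"
      by (rule continuous_on_compose2[OF cont]) (auto simp: self_adjoint_spec)
    then show ?thesis unfolding \<delta>_def M_def
      by (intro continuous_on_component continuous_on_matrix_mult continuous_on_const)
  qed
  define C :: "(real, 'n) vec set" where "C = {d. \<forall>i j. i < j \<longrightarrow> d $ i < d $ j}"
  have "convex C"
  proof (rule convexI)
    fix x y :: "(real, 'n) vec" and s t :: real
    assume *: "x \<in> C" "y \<in> C" "0 \<le> s" "0 \<le> t" "s + t = 1"
    have "s * x $ i + t * y $ i < s * x $ j + t * y $ j" if "i < j" for i j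
    proof (cases "s = 0")
      case False
      have "x $ i < x $ j" "y $ i < y $ j" using * that by (auto simp: C_def)
      then show ?thesis using * False by (intro add_less_le_mono mult_left_mono) auto
    qed (use * that in \<open>auto simp: C_def\<close>)
    then show "s *\<^sub>R x + t *\<^sub>R y \<in> C" by (simp add: C_def)
  qed
  then have "connected C" by (rule convex_connected)
  have d0C: "d0 \<in> C" using less_d0 by (simp add: C_def)
  have on_C: "\<delta> d i = of_real (d $ i)" if d: "d \<in> C" for d i
  proof (rule ccontr)
    assume neq: "\<delta> d i \<noteq> of_real (d $ i)"
    \<comment> \<open>On the chamber \<open>\<delta> d i\<close> is one of the entries of d. Being
      the entry at i and being another entry are both closed conditions, and they exclude each other
      there because the entries are distinct.\<close>
    define A where "A = {d. \<delta> d i = of_real (d $ i)}"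
    define B where "B = (\<Union>j\<in>UNIV - {i}. {d. \<delta> d i = of_real (d $ j)})"
    have cl: "closed {d. \<delta> d i = of_real (d $ j)}" for j
      by (intro closed_Collect_eq cont_\<delta> continuous_on_of_real continuous_on_component continuous_on_id)
    have "closed A" unfolding A_def by (rule cl)
    moreover have "closed B" unfolding B_def by (intro closed_UN) (auto intro: cl)
    moreover have cover: "C \<subseteq> A \<union> B"
    proof
      fix d assume "d \<in> C"
      have "\<delta> d i \<in> range (\<lambda>i. of_real (d $ i))" using range_\<delta>[of d] by (metis rangeI)
      then show "d \<in> A \<union> B" by (auto simp: A_def B_def)
    qed
    moreover have "A \<inter> B \<inter> C = {}"
    proof -
      have "d $ i \<noteq> d $ j" if "d \<in> C" "j \<noteq> i" for d j
      proof -
        have "i < j \<Longrightarrow> d $ i < d $ j" "j < i \<Longrightarrow> d $ j < d $ i" using that by (auto simp: C_def)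
        then show ?thesis using that(2) by (cases i j rule: linorder_cases) auto
      qed
      then show ?thesis by (auto simp: A_def B_def) metis
    qed
    moreover have "d0 \<in> A \<inter> C" using d0C by (simp add: A_def \<delta>_d0 a_def)
    moreover have "d \<in> B \<inter> C" using cover d neq by (auto simp: A_def)
    ultimately show False using \<open>connected C\<close> unfolding connected_closed by blast
  qed
  have "\<delta> d i = of_real (d $ i)" if d: "increasing d" for d i
  proof -
    \<comment> \<open>Moving a weakly increasing d in the direction \<open>d0\<close> enters the
      chamber at once; the equation passes to the limit e = 0 by closedness.\<close>
    define E where "E = {e. \<delta> (d + e *\<^sub>R d0) i = of_real ((d + e *\<^sub>R d0) $ i)}"
    have "continuous_on UNIV (\<lambda>e. \<delta> (d + e *\<^sub>R d0) i)"
      by (rule continuous_on_compose2[OF cont_\<delta>[of UNIV]]) (auto intro!: continuous_intros)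
    then have "closed E" unfolding E_def
      by (intro closed_Collect_eq continuous_on_of_real continuous_on_component continuous_intros)
    moreover have "{0<..} \<subseteq> E"
    proof
      fix e :: real assume e: "e \<in> {0<..}"
      have "d + e *\<^sub>R d0 \<in> C"
        using d e less_d0 by (auto simp: C_def increasing_def intro!: add_le_less_mono)
      then show "e \<in> E" by (simp add: E_def on_C)
    qed
    ultimately have "closure {0<..} \<subseteq> E" by (intro closure_minimal)
    then have "0 \<in> E" by auto
    then show ?thesis by (simp add: E_def)
  qed
  then show ?thesis using T rep range_\<delta> by (intro exI[of _ T] exI[of _ \<delta>]) auto
qed

text \<open>The index sets are first moved to final segments, where the diagonalization is explicit.\<close>

lemma proj_pair:
  assumes u: "frame u" and sub: "S \<subseteq> S'"
  shows "trace (\<phi> (proj (u ` S))) = of_nat (card S)"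
    and "\<phi> (proj (u ` S)) ** \<phi> (proj (u ` S')) = \<phi> (proj (u ` S))"
proof -
  \<comment> \<open>Sorting the indices by how many of the two sets contain them turns both nested
    sets into final segments at the same time.\<close>
  obtain p :: "'n \<Rightarrow> 'n" where p: "bij p"
    and mono: "\<And>i j. i \<le> j \<Longrightarrow>
      of_bool (p i \<in> S) + of_bool (p i \<in> S') \<le> (of_bool (p j \<in> S) + of_bool (p j \<in> S') :: real)"
    using exists_sorting[of "\<lambda>i. of_bool (i \<in> S) + of_bool (i \<in> S')"] by auto
  obtain T \<delta> where T: "invertible T"
    and rep: "\<forall>d. \<phi> (spec (u \<circ> p) d) = T ** diag_mat (\<delta> d) ** matrix_inv T"
    and inc: "\<forall>d. increasing d \<longrightarrow> \<delta> d = (\<lambda>i. of_real (d $ i))"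
    using frame_diagonalization[OF frame_comp[OF u bij_is_inj[OF p]]] by auto
  have "\<phi> (proj (u ` R)) = cproj T (p -` R)"
    if "\<And>i j. i \<le> j \<Longrightarrow> p i \<in> R \<Longrightarrow> p j \<in> R" for R
  proof -
    have "proj (u ` R) = spec (u \<circ> p) (\<chi> i. of_bool (p i \<in> R))"
      using spec_comp[OF p, of u "\<chi> i. of_bool (i \<in> R)"] spec_indicator[OF u, of R] by simp
    moreover have "increasing (\<chi> i. of_bool (p i \<in> R))"
      using that by (auto simp: increasing_def)
    ultimately show ?thesis
      using rep inc by (simp add: cproj_def of_bool_def if_distrib[of complex_of_real] cong: if_cong)
  qed
  moreover have "p j \<in> S" if "i \<le> j" "p i \<in> S" for i j
    using mono[OF that(1)] that(2) sub by (auto split: if_splits simp: of_bool_def)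
  moreover have "p j \<in> S'" if "i \<le> j" "p i \<in> S'" for i j
    using mono[OF that(1)] that(2) sub by (auto split: if_splits simp: of_bool_def)
  ultimately have eq: "\<phi> (proj (u ` S)) = cproj T (p -` S)" "\<phi> (proj (u ` S')) = cproj T (p -` S')"
    by blast+
  have "card (p -` S) = card S"
    using p by (metis bij_is_inj bij_is_surj card_vimage_inj subset_UNIV)
  then show "trace (\<phi> (proj (u ` S))) = of_nat (card S)"
    by (simp add: eq trace_cproj[OF T])
  have "p -` S \<inter> p -` S' = p -` S" using sub by auto
  then show "\<phi> (proj (u ` S)) ** \<phi> (proj (u ` S')) = \<phi> (proj (u ` S))"
    by (simp add: eq cproj_mult[OF T])
qed

text \<open>The image of a projection has its spectrum in {0, 1}, so its diagonal is the indicator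
  of a set \<open>\<sigma> S\<close>; the trace gives the size and products with larger projections
  give monotonicity. For the sorted-eigenvalue map \<open>\<sigma> S\<close> depends on the size of
  S only.\<close>

lemma frame_structure:
  assumes u: "frame u"
  shows "\<exists>T \<sigma>. invertible T
    \<and> (\<forall>d. increasing d \<longrightarrow> \<phi> (spec u d) = T ** diag_mat (\<lambda>i. of_real (d $ i)) ** matrix_inv T)
    \<and> (\<forall>S. \<phi> (proj (u ` S)) = cproj T (\<sigma> S)) \<and> (\<forall>S. card (\<sigma> S) = card S)
    \<and> (\<forall>S S'. S \<subseteq> S' \<longrightarrow> \<sigma> S \<subseteq> \<sigma> S')"
proof -
  obtain T \<delta> where T: "invertible T"
    and rep: "\<forall>d. \<phi> (spec u d) = T ** diag_mat (\<delta> d) ** matrix_inv T"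
    and ran: "\<forall>d. range (\<delta> d) = range (\<lambda>i. of_real (d $ i))"
    and inc: "\<forall>d. increasing d \<longrightarrow> \<delta> d = (\<lambda>i. of_real (d $ i))"
    using frame_diagonalization[OF u] by auto
  define \<sigma> where "\<sigma> S = {i. \<delta> (\<chi> i. of_bool (i \<in> S)) i = 1}" for S
  have "\<delta> (\<chi> i. of_bool (i \<in> S)) i = of_bool (i \<in> \<sigma> S)" for S i
  proof -
    have "\<delta> (\<chi> i. of_bool (i \<in> S)) i \<in> range (\<lambda>i. complex_of_real ((\<chi> i. of_bool (i \<in> S)) $ i))"
      using ran by (metis rangeI)
    then show ?thesis by (auto simp: \<sigma>_def)
  qed
  then have "\<delta> (\<chi> i. of_bool (i \<in> S)) = (\<lambda>i. of_bool (i \<in> \<sigma> S))" for S by auto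
  then have \<sigma>: "\<phi> (proj (u ` S)) = cproj T (\<sigma> S)" for S
    using rep[rule_format, of "\<chi> i. of_bool (i \<in> S)"] spec_indicator[OF u, of S]
    by (simp add: cproj_def)
  have "card (\<sigma> S) = card S" for S
    using proj_pair(1)[OF u order_refl, of S] by (simp add: \<sigma> trace_cproj[OF T])
  moreover have "\<sigma> S \<subseteq> \<sigma> S'" if "S \<subseteq> S'" for S S'
  proof -
    have "cproj T (\<sigma> S \<inter> \<sigma> S') = cproj T (\<sigma> S)"
      using proj_pair(2)[OF u that] by (simp add: \<sigma> cproj_mult[OF T])
    then show ?thesis by (simp add: cproj_inject[OF T] Int_absorb2 le_iff_inf)
  qed
  ultimately show ?thesis using T \<sigma> rep inc by (intro exI[of _ T] exI[of _ \<sigma>]) auto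
qed

lemma basis_structure:
  assumes B: "orthonormal B" "card B = CARD('n)"
  shows "\<exists>T \<tau>. invertible T \<and> (\<forall>S\<subseteq>B. \<phi> (proj S) = cproj T (\<tau> S)) \<and> (\<forall>S\<subseteq>B. card (\<tau> S) = card S)
    \<and> (\<forall>S S'. S \<subseteq> S' \<longrightarrow> S' \<subseteq> B \<longrightarrow> \<tau> S \<subseteq> \<tau> S')"
proof -
  obtain u where u: "frame u" "range u = B" using frame_of_basis[OF B] by auto
  obtain T \<sigma> where T: "invertible T" "\<forall>S. \<phi> (proj (u ` S)) = cproj T (\<sigma> S)"
    "\<forall>S. card (\<sigma> S) = card S" "\<forall>S S'. S \<subseteq> S' \<longrightarrow> \<sigma> S \<subseteq> \<sigma> S'"
    using frame_structure[OF u(1)] by auto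
  have im: "u ` (u -` S) = S" if "S \<subseteq> B" for S using that u(2) by auto
  have "card (u -` S) = card S" if "S \<subseteq> B" for S
    using card_vimage_inj[OF frame_inj[OF u(1)], of S] that u(2) by simp
  moreover have "\<phi> (proj S) = cproj T (\<sigma> (u -` S))" if "S \<subseteq> B" for S
    using T(2)[rule_format, of "u -` S"] im[OF that] by simp
  ultimately show ?thesis using T
    by (intro exI[of _ T] exI[of _ "\<lambda>S. \<sigma> (u -` S)"]) (auto simp: vimage_mono)
qed

end

section \<open>Integer-valued functions of orthogonal pairs\<close>

text \<open>For fixed x, two admissible partners are joined by a normalized segment, along which a
  continuous integer-valued function is constant; antipodal partners, whose segment meets 0, are
  covered by \<open>minus\<close>. A vector c orthogonal to N, x and x' then links (x, y), (x, c),
  (c, x') and (x', y').\<close>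

lemma orthogonal_pairs_constant:
  fixes \<tau> :: "complex^'n::finite \<Rightarrow> complex^'n \<Rightarrow> complex"
  assumes N: "finite N" "card N + 3 \<le> CARD('n)"
    and Z: "Z = {x. norm x = 1 \<and> (\<forall>b\<in>N. cip x b = 0)}"
    and cont: "\<And>x. x \<in> Z \<Longrightarrow> continuous_on Z (\<tau> x)"
    and sym: "\<And>x y. \<tau> x y = \<tau> y x"
    and minus: "\<And>x y. \<tau> x (- y) = \<tau> x y"
    and int: "\<And>x y. x \<in> Z \<Longrightarrow> y \<in> Z \<Longrightarrow> cip x y = 0 \<Longrightarrow> \<tau> x y \<in> \<int>"
    and xy: "x \<in> Z" "y \<in> Z" "cip x y = 0" and xy': "x' \<in> Z" "y' \<in> Z" "cip x' y' = 0"
  shows "\<tau> x y = \<tau> x' y'"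
proof -
  have step: "\<tau> x y = \<tau> x y'"
    if x: "x \<in> Z" and y: "y \<in> Z" "cip x y = 0" and y': "y' \<in> Z" "cip x y' = 0" for x y y'
  proof (cases "y' = - y")
    case False
    define \<gamma> where "\<gamma> t = (1 - t) *\<^sub>R y + t *\<^sub>R y'" for t :: real
    have norms: "norm y = 1" "norm y' = 1" using y y' by (auto simp: Z)
    have nz: "\<gamma> t \<noteq> 0" if "t \<in> {0..1}" for t
    proof
      assume 0: "\<gamma> t = 0"
      then have "t *\<^sub>R y' = - ((1 - t) *\<^sub>R y)" by (simp add: \<gamma>_def eq_neg_iff_add_eq_0 add.commute)
      then have "norm (t *\<^sub>R y') = norm ((1 - t) *\<^sub>R y)" by simp
      then have t: "t = 1 / 2" using that norms by auto
      have "(1 / 2) *\<^sub>R (y + y') = 0"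
        using 0 unfolding \<gamma>_def t by (simp add: scaleR_right_distrib)
      then show False using False by (simp add: eq_neg_iff_add_eq_0 add.commute)
    qed
    have mem: "sgn (\<gamma> t) \<in> Z" "cip x (sgn (\<gamma> t)) = 0" if "t \<in> {0..1}" for t
    proof -
      have "cip (sgn (\<gamma> t)) b = 0" if "b \<in> N" for b
        using y(1) y'(1) that by (simp add: Z sgn_div_norm \<gamma>_def cip_add cip_scaleR)
      then show "sgn (\<gamma> t) \<in> Z" using nz[OF that] by (simp add: Z norm_sgn)
      show "cip x (sgn (\<gamma> t)) = 0"
        using y(2) y'(2) by (simp add: sgn_div_norm \<gamma>_def cip_add cip_scaleR)
    qed
    have "continuous_on {0..1} (\<lambda>t. sgn (\<gamma> t))"
      using nz by (auto simp: \<gamma>_def intro!: continuous_intros)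
    then have "continuous_on {0..1} (\<lambda>t. \<tau> x (sgn (\<gamma> t)))"
      by (rule continuous_on_compose2[OF cont[OF x]]) (use mem in auto)
    moreover have "\<exists>e>0. \<forall>s. s \<in> {0..1} \<and> \<tau> x (sgn (\<gamma> s)) \<noteq> \<tau> x (sgn (\<gamma> t)) \<longrightarrow>
        e \<le> norm (\<tau> x (sgn (\<gamma> s)) - \<tau> x (sgn (\<gamma> t)))" if t: "t \<in> {0..1}" for t
    proof (intro exI[of _ 1] conjI allI impI)
      fix s :: real
      assume s: "s \<in> {0..1} \<and> \<tau> x (sgn (\<gamma> s)) \<noteq> \<tau> x (sgn (\<gamma> t))"
      obtain k l where kl: "\<tau> x (sgn (\<gamma> s)) = of_int k" "\<tau> x (sgn (\<gamma> t)) = of_int l"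
        using int[OF x mem[of s]] int[OF x mem[OF t]] s by (auto elim!: Ints_cases)
      then have "k \<noteq> l" using s by auto
      have "norm (complex_of_int k - of_int l) = \<bar>real_of_int (k - l)\<bar>"
        by (metis norm_of_int of_int_diff)
      then show "1 \<le> norm (\<tau> x (sgn (\<gamma> s)) - \<tau> x (sgn (\<gamma> t)))"
        using \<open>k \<noteq> l\<close> by (simp add: kl)
    qed simp
    ultimately have "(\<lambda>t. \<tau> x (sgn (\<gamma> t))) constant_on {0..1}"
      by (intro continuous_discrete_range_constant) (auto simp: connected_Icc)
    then have "\<tau> x (sgn (\<gamma> 0)) = \<tau> x (sgn (\<gamma> 1))" unfolding constant_on_def by force
    then show ?thesis using norms by (simp add: \<gamma>_def sgn_div_norm)
  qed (simp add: minus)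
  have "card (N \<union> {x, x'}) < CARD('n)"
    using N card_Un_le[of N "{x, x'}"] card_insert_le_m1[of 2 "{x'}" x] by auto
  then obtain c where c: "norm c = 1" "\<forall>b\<in>N \<union> {x, x'}. cip c b = 0"
    using exists_orthogonal_unit[of "N \<union> {x, x'}"] N(1) by auto
  then have cZ: "c \<in> Z" and cx: "cip x c = 0" "cip x' c = 0" "cip c x = 0" "cip c x' = 0"
    by (auto simp: Z cip_eq_0_commute[of _ c])
  have "\<tau> x y = \<tau> x c" by (rule step) (use xy cZ cx in auto)
  also have "\<dots> = \<tau> c x'" unfolding sym[of x c] by (rule step) (use xy xy' cZ cx in auto)
  also have "\<dots> = \<tau> x' y'" unfolding sym[of c x'] by (rule step) (use xy xy' cZ cx in auto)
  finally show ?thesis .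
qed

lemma card_eq_1_disjoint_or_eq:
  "card A = 1 \<Longrightarrow> card B = 1 \<Longrightarrow> A = B \<or> A \<inter> B = {}"
  by (auto simp: card_1_singleton_iff)

text \<open>\<open>t - s0\<close> has two elements, and each of the three sets is s0 together with
  one of them.\<close>

lemma two_of_three_equal:
  assumes "finite t" "card t = k + 2" "card s0 = k"
    and "s0 \<subseteq> s1" "s0 \<subseteq> s2" "s0 \<subseteq> s3" "s1 \<subseteq> t" "s2 \<subseteq> t" "s3 \<subseteq> t"
    and "card s1 = k + 1" "card s2 = k + 1" "card s3 = k + 1"
  shows "s1 = s2 \<or> s2 = s3 \<or> s1 = s3"
proof -
  have fin: "finite s0" "finite s1" "finite s2" "finite s3"
    using assms(4-9) finite_subset[OF _ assms(1)] by auto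
  have "card (t - s0) = 2" using assms fin by (subst card_Diff_subset) auto
  then obtain p q where pq: "t - s0 = {p, q}" by (auto simp: card_2_iff)
  have sgl: "s = insert p s0 \<or> s = insert q s0"
    if "s0 \<subseteq> s" "s \<subseteq> t" "card s = k + 1" "finite s" for s
  proof -
    have "card (s - s0) = 1" using that assms(3) fin by (subst card_Diff_subset) auto
    then obtain r where r: "s - s0 = {r}" by (auto simp: card_1_singleton_iff)
    then have "r \<in> t - s0" using that by auto
    then have "r = p \<or> r = q" using pq by auto
    moreover have "s = insert r s0" using r that(1) by auto
    ultimately show ?thesis by auto
  qed
  show ?thesis using sgl[of s1] sgl[of s2] sgl[of s3] assms fin by auto
qed

text \<open>The left side thus depends on T only through the idempotents \<open>cproj T {k}\<close>,
  and two different T can be exchanged once these agree.\<close>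

lemma conj_diag_sum:
  fixes T :: "'n::finite cmatrix"
  shows "T ** diag_mat (\<lambda>i. of_real (d $ i)) ** matrix_inv T = (\<Sum>k\<in>UNIV. d $ k *\<^sub>R cproj T {k})"
proof -
  have "diag_mat (\<lambda>i. of_real (d $ i)) = (\<Sum>k\<in>UNIV. d $ k *\<^sub>R diag_mat (\<lambda>i. of_bool (i \<in> {k})))"
    unfolding vec_eq_iff
  proof (intro allI)
    fix i j :: 'n
    have "(\<Sum>k\<in>UNIV. d $ k *\<^sub>R (of_bool (i = k) :: complex)) = (\<Sum>k\<in>UNIV. if i = k then of_real (d $ k) else 0)"
      by (intro sum.cong) (auto simp: scaleR_conv_of_real)
    also have "\<dots> = of_real (d $ i)" by simp
    finally show "diag_mat (\<lambda>i. of_real (d $ i)) $ i $ j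
        = (\<Sum>k\<in>UNIV. d $ k *\<^sub>R diag_mat (\<lambda>i. of_bool (i \<in> {k}))) $ i $ j"
      by (cases "i = j") (auto simp: diag_mat_def)
  qed
  then show ?thesis
    by (simp add: cproj_def matrix_mult_sum matrix_mult_scaleR)
qed

text \<open>Because of the last claim the sum over the triple is the same for every orthonormal
  basis of the complement of N, so a plane there can be described by its normal vector
  alone.\<close>

lemma orthonormal_triple:
  fixes N :: "(complex^'n::finite) set"
  assumes N: "orthonormal N" "card N + 3 = CARD('n)"
    and unit: "norm x = 1" "norm y = 1" "norm z = 1"
    and perp: "\<And>b. b \<in> N \<Longrightarrow> cip x b = 0" "\<And>b. b \<in> N \<Longrightarrow> cip y b = 0" "\<And>b. b \<in> N \<Longrightarrow> cip z b = 0"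
    and orth: "cip x y = 0" "cip x z = 0" "cip y z = 0"
  shows "orthonormal (insert x (insert y (insert z N)))"
    and "card (insert x (insert y (insert z N))) = CARD('n)"
    and "x \<notin> insert y (insert z N)" "y \<notin> insert z N" "z \<notin> N"
    and "mat 1 - proj N = outer x + outer y + outer z"
proof -
  have z: "orthonormal (insert z N)" "z \<notin> N" using orthonormal_insert[of N z] assms by auto
  have y: "orthonormal (insert y (insert z N))" "y \<notin> insert z N"
    using orthonormal_insert[OF z(1), of y] assms by auto
  have x: "orthonormal (insert x (insert y (insert z N)))" "x \<notin> insert y (insert z N)"
    using orthonormal_insert[OF y(1), of x] assms by auto
  have fin: "finite N" using N by (simp add: orthonormal_def)
  show "orthonormal (insert x (insert y (insert z N)))" "x \<notin> insert y (insert z N)"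
    "y \<notin> insert z N" "z \<notin> N" using x y z by auto
  show card: "card (insert x (insert y (insert z N))) = CARD('n)" using x y z fin N(2) by simp
  have "mat 1 = proj (insert x (insert y (insert z N)))" using proj_basis'[OF x(1) card] by simp
  then show "mat 1 - proj N = outer x + outer y + outer z"
    using proj_insert[OF y(1) x(2)] proj_insert[OF z(1) y(2)] proj_insert[OF N(1) z(2)] by simp
qed

text \<open>Induction on \<open>m\<close>: independence of \<open>b\<close> turns \<open>h\<close> into a function of \<open>W\<close>, and exchanging
  the order in which two vectors are added shows that this function has the same property one
  dimension lower.\<close>

lemma orthonormal_descent:
  fixes h :: "'n::finite cmatrix \<Rightarrow> 'b"
  assumes "m + 1 < CARD('n)"
    and "\<And>W b b'. orthonormal W \<Longrightarrow> card W = m \<Longrightarrow> norm b = 1 \<Longrightarrow> norm b' = 1 \<Longrightarrow>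
      \<forall>w\<in>W. cip b w = 0 \<Longrightarrow> \<forall>w\<in>W. cip b' w = 0 \<Longrightarrow> h (proj W + outer b) = h (proj W + outer b')"
    and "orthonormal W" "card W = m" "norm b = 1" "\<forall>w\<in>W. cip b w = 0"
    and "orthonormal W'" "card W' = m" "norm b' = 1" "\<forall>w\<in>W'. cip b' w = 0"
  shows "h (proj W + outer b) = h (proj W' + outer b')"
  using assms
proof (induction m arbitrary: h W b W' b')
  case 0
  then have "W = {}" "W' = {}" by (auto simp: orthonormal_def)
  then show ?case using "0.prems"(2)[of "{}" b b'] "0.prems"(5,9) by simp
next
  case (Suc m)
  note adj = Suc.prems(2)
  \<comment> \<open>\<open>h'\<close> has to be a function of the matrix. The matrix determines
    which unit vectors may be added, and the choice among them is immaterial by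
    \<open>adj\<close>.\<close>
  define h' where "h' M = h (M + outer (SOME b. norm b = 1 \<and> M *v b = 0))" for M
  have h': "h' (proj W) = h (proj W + outer b)"
    if W: "orthonormal W" "card W = Suc m" and b: "norm b = 1" "\<forall>w\<in>W. cip b w = 0" for W b
  proof -
    let ?e = "SOME b. norm b = 1 \<and> proj W *v b = 0"
    have "norm ?e = 1 \<and> proj W *v ?e = 0"
      by (rule someI[of _ b]) (use b W in \<open>simp add: proj_mult_vec_eq_0\<close>)
    then show ?thesis unfolding h'_def
      by (intro adj W b) (use W in \<open>auto simp: proj_mult_vec_eq_0\<close>)
  qed
  have adj': "h' (proj X + outer c) = h' (proj X + outer c')"
    if X: "orthonormal X" "card X = m" and c: "norm c = 1" "norm c' = 1"
      "\<forall>w\<in>X. cip c w = 0" "\<forall>w\<in>X. cip c' w = 0" for X c c'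
  proof -
    have fin: "finite X" using X by (simp add: orthonormal_def)
    have "card (X \<union> {c, c'}) < CARD('n)"
      using X card_Un_le[of X "{c, c'}"] card_insert_le_m1[of 2 "{c'}" c] Suc.prems(1) by auto
    then obtain e where e: "norm e = 1" "\<forall>w\<in>X \<union> {c, c'}. cip e w = 0"
      using exists_orthogonal_unit[of "X \<union> {c, c'}"] fin by auto
    have oe: "orthonormal (insert e X)" "e \<notin> X" using orthonormal_insert[of X e] X e by auto
    have *: "h' (proj X + outer v) = h (proj (insert e X) + outer v)"
      if v: "norm v = 1" "\<forall>w\<in>X. cip v w = 0" "cip e v = 0" for v
    proof -
      have ov: "orthonormal (insert v X)" "v \<notin> X" using orthonormal_insert[of X v] X v by auto
      have "h' (proj (insert v X)) = h (proj (insert v X) + outer e)"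
        using ov X fin e v by (intro h') auto
      then show ?thesis using ov oe by (simp add: proj_insert[OF X(1)] add_ac)
    qed
    have "h (proj (insert e X) + outer c) = h (proj (insert e X) + outer c')"
      using oe X fin c e by (intro adj) (auto simp: cip_eq_0_commute[of _ e])
    then show ?thesis using *[of c] *[of c'] c e by simp
  qed
  have split: "\<exists>X c. W = insert c X \<and> c \<notin> X \<and> orthonormal X \<and> card X = m \<and> norm c = 1 \<and> (\<forall>w\<in>X. cip c w = 0)"
    if W: "orthonormal W" "card W = Suc m" for W :: "(complex^'n) set"
  proof -
    obtain c X where cX: "W = insert c X" "c \<notin> X" "card X = m"
      using W(2) by (auto simp: card_Suc_eq)
    then show ?thesis using W(1)
      by (intro exI[of _ X] exI[of _ c])
        (auto simp: orthonormal_def cip_self_eq_1[symmetric])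
  qed
  obtain X c where X: "W = insert c X" "c \<notin> X" "orthonormal X" "card X = m" "norm c = 1" "\<forall>w\<in>X. cip c w = 0"
    using split[OF Suc.prems(3,4)] by auto
  obtain X' c' where X': "W' = insert c' X'" "c' \<notin> X'" "orthonormal X'" "card X' = m" "norm c' = 1"
      "\<forall>w\<in>X'. cip c' w = 0"
    using split[OF Suc.prems(7,8)] by auto
  have "h' (proj X + outer c) = h' (proj X' + outer c')"
  proof (rule Suc.IH[of h'])
    show "m + 1 < CARD('n)" using Suc.prems(1) by simp
  qed (rule adj' X X'; assumption)+
  then have "h' (proj W) = h' (proj W')" using X X' by (simp add: proj_insert)
  then show ?case using h'[OF Suc.prems(3-6)] h'[OF Suc.prems(7-10)] by simp
qed

section \<open>Dichotomy for orthogonal pairs, and the case of coinciding images\<close>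

context CS_map begin

lemma continuous_on_phi_compose:
  "continuous_on A g \<Longrightarrow> (\<And>x. x \<in> A \<Longrightarrow> g x \<in> self_adjoint_matrices) \<Longrightarrow> continuous_on A (\<lambda>x. \<phi> (g x))"
  by (rule continuous_on_compose2[OF cont]) auto

text \<open>In a basis containing a and b the two images belong to one-element index sets, which are
  equal or disjoint. The trace is included because it tells the cases apart by an integer.\<close>

lemma orthogonal_pair_cases:
  assumes n: "CARD('n) \<ge> 3" and a: "norm a = 1" and b: "norm b = 1" and ab: "cip a b = 0"
  shows "\<phi> (outer a) = \<phi> (outer b) \<and> trace (\<phi> (outer a) ** \<phi> (outer b)) = 1
    \<or> \<phi> (outer a) ** \<phi> (outer b) = 0 \<and> trace (\<phi> (outer a) ** \<phi> (outer b)) = 0"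
proof -
  have "orthonormal {b}" using b by (auto simp: orthonormal_def cip_self_eq_1)
  then have "orthonormal {a, b}" using orthonormal_insert[of "{b}" a] a ab by auto
  moreover have "card {a, b} \<le> CARD('n)" using card_insert_le_m1[of 2 "{b}" a] n by auto
  ultimately obtain B where B: "{a, b} \<subseteq> B" "orthonormal B" "card B = CARD('n)"
    using orthonormal_extend_basis[of "{a, b}"] by auto
  obtain T \<tau> where T: "invertible T" and rep: "\<forall>S\<subseteq>B. \<phi> (proj S) = cproj T (\<tau> S)"
    and card: "\<forall>S\<subseteq>B. card (\<tau> S) = card S"
    using basis_structure[OF B(2,3)] by auto
  have sgl: "\<phi> (outer a) = cproj T (\<tau> {a})" "\<phi> (outer b) = cproj T (\<tau> {b})"
    "card (\<tau> {a}) = 1" "card (\<tau> {b}) = 1"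
    using rep[rule_format, of "{a}"] rep[rule_format, of "{b}"]
      card[rule_format, of "{a}"] card[rule_format, of "{b}"] B(1) by (auto simp: proj_def)
  have "cproj T {} = 0" by (simp add: cproj_def diag_mat_def zero_vec_def[symmetric])
  then show ?thesis using card_eq_1_disjoint_or_eq[OF sgl(3,4)] sgl(3)
    by (auto simp: sgl cproj_mult[OF T] trace_cproj[OF T])
qed

text \<open>A counterexample to each alternative would give the trace of the product the values 0
  and 1, against its constancy on orthonormal pairs; the set N of
  \<open>orthogonal_pairs_constant\<close> is empty here.\<close>

lemma orthogonal_pair_dichotomy:
  assumes n: "CARD('n) \<ge> 3"
  shows "(\<forall>a b. norm a = 1 \<longrightarrow> norm b = 1 \<longrightarrow> cip a b = 0 \<longrightarrow> \<phi> (outer a) = \<phi> (outer b)) \<or>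
    (\<forall>a b. norm a = 1 \<longrightarrow> norm b = 1 \<longrightarrow> cip a b = 0 \<longrightarrow> \<phi> (outer a) ** \<phi> (outer b) = 0)"
proof (rule ccontr)
  assume "\<not> ?thesis"
  then obtain a b a' b' where
    ab: "norm a = 1" "norm b = 1" "cip a b = 0" "\<phi> (outer a) \<noteq> \<phi> (outer b)" and
    ab': "norm a' = 1" "norm b' = 1" "cip a' b' = 0" "\<phi> (outer a') ** \<phi> (outer b') \<noteq> 0"
    by auto
  have "trace (\<phi> (outer a) ** \<phi> (outer b)) = trace (\<phi> (outer a') ** \<phi> (outer b'))"
  proof (rule orthogonal_pairs_constant[of "{}" "{x. norm x = 1}"
        "\<lambda>x y. trace (\<phi> (outer x) ** \<phi> (outer y))" a b a' b'])
    show "continuous_on {x. norm x = 1} (\<lambda>y. trace (\<phi> (outer x) ** \<phi> (outer y)))" for x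
      unfolding trace_def
      by (intro continuous_on_sum continuous_on_component continuous_on_matrix_mult
          continuous_on_const continuous_on_phi_compose continuous_on_outer continuous_on_id
          self_adjoint_outer)
    show "trace (\<phi> (outer x) ** \<phi> (outer y)) \<in> \<int>"
      if "x \<in> {x. norm x = 1}" "y \<in> {x. norm x = 1}" "cip x y = 0" for x y
      using orthogonal_pair_cases[OF n, of x y] that by auto
  qed (use n ab ab' in \<open>auto intro: trace_mul_sym\<close>)
  then show False
    using orthogonal_pair_cases[OF n ab(1-3)] orthogonal_pair_cases[OF n ab'(1-3)] ab(4) ab'(4)
    by auto
qed

text \<open>In a three-dimensional space spanned by \<open>x\<close>, \<open>y\<close>, \<open>z\<close> the three planes have images that differ
  from one common projection by rank one and lie below a common one of rank two more, so two of them
  agree. Connectedness of the set of orthonormal pairs then makes all of them agree.\<close>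

lemma adjacent_projections:
  assumes m: "1 \<le> m" "m + 2 \<le> CARD('n)"
    and IH: "\<And>A A'. orthonormal A \<Longrightarrow> orthonormal A' \<Longrightarrow> card A = m \<Longrightarrow> card A' = m \<Longrightarrow>
      \<phi> (proj A) = \<phi> (proj A')"
    and W: "orthonormal W" "card W = m" and b: "norm b = 1" "\<forall>w\<in>W. cip b w = 0"
    and b': "norm b' = 1" "\<forall>w\<in>W. cip b' w = 0"
  shows "\<phi> (proj W + outer b) = \<phi> (proj W + outer b')"
proof -
  obtain k where k: "m = Suc k" using m(1) by (cases m) auto
  obtain c A where cA: "W = insert c A" "c \<notin> A" "card A = k"
    using W(2) unfolding k by (auto simp: card_Suc_eq)
  have A: "orthonormal A" using W(1) cA(1) by (auto intro: orthonormal_subset)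
  have c: "norm c = 1" "\<forall>w\<in>A. cip w c = 0"
    using W(1) cA by (auto simp: orthonormal_def cip_self_eq_1[symmetric])
  \<comment> \<open>Completing A to n - 3 vectors inside the complement of c, b and b' leaves a
    three-dimensional space that contains all three of them.\<close>
  have "\<exists>N. A \<subseteq> N \<and> orthonormal N \<and> card N = CARD('n) - 3 \<and> (\<forall>a\<in>N. \<forall>d\<in>{c, b, b'}. cip a d = 0)"
  proof (rule orthonormal_extend[OF A])
    have "card {c, b, b'} \<le> 3" by (simp add: card_insert_if)
    then show "CARD('n) - 3 + card {c, b, b'} \<le> CARD('n)" using m k by linarith
  qed (use c b b' cA k m in \<open>auto simp: cip_eq_0_commute\<close>)
  then obtain N where N: "A \<subseteq> N" "orthonormal N" "card N = CARD('n) - 3"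
    "\<forall>a\<in>N. \<forall>d\<in>{c, b, b'}. cip a d = 0" by auto
  have N3: "card N + 3 = CARD('n)" using N(3) m k by linarith
  have finN: "finite N" "finite A" using N(2) A by (auto simp: orthonormal_def)
  define Z where "Z = {x. norm x = 1 \<and> (\<forall>b\<in>N. cip x b = 0)}"
  \<comment> \<open>For x in Z, the image of the projection onto A and the plane orthogonal to x in
    the complement of N, of rank m + 1. Describing the plane by its normal makes q continuous on
    Z.\<close>
  define q where "q x = \<phi> (proj A + (mat 1 - proj N) - outer x)" for x
  have third: "\<exists>z\<in>Z. cip x z = 0 \<and> cip y z = 0" for x y
  proof -
    have "card (N \<union> {x, y}) < CARD('n)"
      using N3 card_Un_le[of N "{x, y}"] card_insert_le_m1[of 2 "{y}" x] by auto
    then show ?thesis using exists_orthogonal_unit[of "N \<union> {x, y}"] finN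
      by (auto simp: Z_def cip_eq_0_commute[of x] cip_eq_0_commute[of y])
  qed
  have q_eq: "q x = \<phi> (proj (insert y (insert z A)))"
    if "x \<in> Z" "y \<in> Z" "z \<in> Z" "cip x y = 0" "cip x z = 0" "cip y z = 0" for x y z
  proof -
    note t = orthonormal_triple[OF N(2) N3, of x y z]
    have "y \<notin> insert z A" "z \<notin> A" "mat 1 - proj N = outer x + outer y + outer z"
      using t that N(1) by (auto simp: Z_def)
    moreover have "orthonormal (insert z A)"
      using t(1) that by (auto simp: Z_def intro: orthonormal_subset[of _ "insert z A"] N(1)[THEN subsetD])
    ultimately show ?thesis
      by (simp add: q_def proj_insert A add_ac)
  qed
  have triple: "(trace (q x ** q y) = of_nat (m + 1) \<or> trace (q y ** q z) = of_nat (m + 1)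
      \<or> trace (q x ** q z) = of_nat (m + 1)) \<and> trace (q x ** q y) \<in> \<int> \<and>
      (trace (q x ** q y) = of_nat (m + 1) \<longrightarrow> q x = q y)"
    if Z: "x \<in> Z" "y \<in> Z" "z \<in> Z" and o: "cip x y = 0" "cip x z = 0" "cip y z = 0" for x y z
  proof -
    note t = orthonormal_triple[OF N(2) N3, of x y z]
    define B where "B = insert x (insert y (insert z N))"
    have B: "orthonormal B" "card B = CARD('n)" and
      ne: "x \<notin> insert y (insert z N)" "y \<notin> insert z N" "z \<notin> N"
      using t Z o by (auto simp: Z_def B_def)
    have AB: "x \<notin> A" "y \<notin> A" "z \<notin> A" "x \<noteq> y" "x \<noteq> z" "y \<noteq> z" using ne N(1) by auto
    obtain T \<tau> where T: "invertible T" and rep: "\<And>S. S \<subseteq> B \<Longrightarrow> \<phi> (proj S) = cproj T (\<tau> S)"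
      and card: "\<And>S. S \<subseteq> B \<Longrightarrow> card (\<tau> S) = card S"
      and mono: "\<And>S S'. S \<subseteq> S' \<Longrightarrow> S' \<subseteq> B \<Longrightarrow> \<tau> S \<subseteq> \<tau> S'"
      using basis_structure[OF B] by auto
    define s1 s2 s3 t where "s1 = \<tau> (insert y (insert z A))" and "s2 = \<tau> (insert x (insert z A))"
      and "s3 = \<tau> (insert x (insert y A))" and "t = \<tau> (insert x (insert y (insert z A)))"
    have sub: "insert x (insert y (insert z A)) \<subseteq> B" using N(1) by (auto simp: B_def)
    have q: "q x = cproj T s1" "q y = cproj T s2" "q z = cproj T s3"
      using q_eq[of x y z] q_eq[of y x z] q_eq[of z x y] Z o sub
      by (auto simp: s1_def s2_def s3_def rep cip_eq_0_commute[of y x] cip_eq_0_commute[of z])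
    \<comment> \<open>All projections of rank m have the same image by \<open>IH\<close>, so the
      three planes lie above one common index set.\<close>
    have eq1: "\<tau> (insert v A) = \<tau> (insert z A)" if "v \<in> {x, y, z}" for v
    proof -
      have "orthonormal (insert v A)" "orthonormal (insert z A)"
        by (rule orthonormal_subset[OF B(1)], use that sub in auto)+
      moreover have "card (insert v A) = m" "card (insert z A) = m"
        using that AB finN cA(3) k by auto
      ultimately have "\<phi> (proj (insert v A)) = \<phi> (proj (insert z A))" by (intro IH)
      moreover have "insert v A \<subseteq> B" "insert z A \<subseteq> B" using that sub by auto
      ultimately show ?thesis by (simp add: rep cproj_inject[OF T])
    qed
    have cards: "card s1 = m + 1" "card s2 = m + 1" "card s3 = m + 1" "card t = m + 2"
      "card (\<tau> (insert z A)) = m"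
      using AB finN cA(3) sub k unfolding s1_def s2_def s3_def t_def by (subst card; auto)+
    have "s1 = s2 \<or> s2 = s3 \<or> s1 = s3"
    proof (rule two_of_three_equal[of t m "\<tau> (insert z A)"])
      show "\<tau> (insert z A) \<subseteq> s1" "\<tau> (insert z A) \<subseteq> s2" unfolding s1_def s2_def
        by (rule mono; use sub in auto)+
      have "\<tau> (insert x A) \<subseteq> s3" unfolding s3_def by (rule mono; use sub in auto)
      then show "\<tau> (insert z A) \<subseteq> s3" using eq1[of x] by simp
      show "s1 \<subseteq> t" "s2 \<subseteq> t" "s3 \<subseteq> t" unfolding s1_def s2_def s3_def t_def
        by (rule mono; use sub in auto)+
    qed (use cards in auto)
    moreover have "card (s1 \<inter> s2) = m + 1 \<longrightarrow> s1 = s2"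
      using cards by (metis card_subset_eq finite inf_le1 inf_le2)
    ultimately show ?thesis
      using cards by (auto simp: q cproj_mult[OF T] trace_cproj[OF T] simp del: of_nat_add of_nat_Suc)
  qed
  have const: "trace (q x ** q y) = trace (q x' ** q y')"
    if "x \<in> Z" "y \<in> Z" "cip x y = 0" "x' \<in> Z" "y' \<in> Z" "cip x' y' = 0" for x y x' y'
  proof (rule orthogonal_pairs_constant[of N Z "\<lambda>x y. trace (q x ** q y)"])
    show "continuous_on Z (\<lambda>y. trace (q x ** q y))" for x
      unfolding trace_def q_def
      by (intro continuous_on_sum continuous_on_component continuous_on_matrix_mult
          continuous_on_const continuous_on_phi_compose continuous_on_outer continuous_on_id
          continuous_on_diff self_adjoint_outer self_adjoint_diff self_adjoint_add self_adjoint_proj)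
        (auto intro!: self_adjointI simp: mat_def)
    show "trace (q x ** q y) \<in> \<int>" if "x \<in> Z" "y \<in> Z" "cip x y = 0" for x y
      using triple[of x y] third[of x y] that by auto
  qed (use N3 finN that Z_def in \<open>auto simp: q_def intro: trace_mul_sym\<close>)
  have q_orth: "q x = q y" if xy: "x \<in> Z" "y \<in> Z" "cip x y = 0" for x y
  proof -
    obtain z where z: "z \<in> Z" "cip x z = 0" "cip y z = 0" using third by blast
    \<comment> \<open>One of the three orthogonal pairs attains the trace m + 1, hence every pair
      does, and this value means equal images.\<close>
    then have "trace (q x ** q y) = of_nat (m + 1)"
      using triple[of x y z] xy const[of x y y z] const[of x y x z] by auto
    then show ?thesis using triple[of x y z] xy z by auto
  qed
  have bcZ: "b \<in> Z" "b' \<in> Z" "c \<in> Z"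
    using N(4) b(1) b'(1) c(1) by (auto simp: Z_def cip_eq_0_commute)
  have bc: "cip b c = 0" "cip b' c = 0" using b(2) b'(2) cA(1) by auto
  have q_b: "\<exists>a\<in>Z. q a = \<phi> (proj W + outer v)" if v: "v \<in> {b, b'}" for v
  proof -
    obtain a where a: "a \<in> Z" "cip v a = 0" "cip c a = 0" using third by blast
    have "q a = \<phi> (proj (insert v (insert c A)))"
      using a v bcZ bc by (intro q_eq) (auto simp: cip_eq_0_commute[of a])
    moreover have "v \<notin> W" using v b b' W(1) by (metis cip_self_eq_1 empty_iff insertE zero_neq_one)
    ultimately show ?thesis using a(1) W(1) by (auto simp: cA(1)[symmetric] proj_insert)
  qed
  obtain a a' where a: "a \<in> Z" "q a = \<phi> (proj W + outer b)" "a' \<in> Z" "q a' = \<phi> (proj W + outer b')"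
    using q_b[of b] q_b[of b'] by auto
  \<comment> \<open>The normals a and a' need not be orthogonal to each other; a vector orthogonal
    to both connects them.\<close>
  obtain e where "e \<in> Z" "cip a e = 0" "cip a' e = 0" using third by blast
  then have "q a = q e" "q a' = q e" using q_orth a by auto
  then show ?thesis using a by simp
qed

text \<open>Induction on the rank. Rank one uses a vector orthogonal to both lines, and full rank
  leaves only the identity matrix; in between, \<open>adjacent_projections\<close> exchanges one
  vector and \<open>orthonormal_descent\<close> connects arbitrary sets.\<close>

lemma constant_on_projections:
  assumes n: "CARD('n) \<ge> 3"
    and const: "\<And>a b. norm a = 1 \<Longrightarrow> norm b = 1 \<Longrightarrow> cip a b = 0 \<Longrightarrow> \<phi> (outer a) = \<phi> (outer b)"
    and A: "orthonormal A" "orthonormal A'" "card A = m" "card A' = m" and m: "m \<le> CARD('n)"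
  shows "\<phi> (proj A) = \<phi> (proj A')"
  using A m
proof (induction m arbitrary: A A')
  case 0
  then have "A = {}" "A' = {}" by (auto simp: orthonormal_def)
  then show ?case by simp
next
  case (Suc m)
  consider "m = 0" | "Suc m = CARD('n)" | "1 \<le> m" "m + 2 \<le> CARD('n)" using Suc.prems by linarith
  then show ?case
  proof cases
    case 1
    then obtain a a' where a: "A = {a}" "A' = {a'}" using Suc.prems by (auto simp: card_1_singleton_iff)
    have "card {a, a'} < CARD('n)" using n card_insert_le_m1[of 2 "{a'}" a] by auto
    then obtain c where c: "norm c = 1" "cip c a = 0" "cip c a' = 0"
      using exists_orthogonal_unit[of "{a, a'}"] by auto
    have "norm a = 1" "norm a' = 1" using Suc.prems a by (auto intro: orthonormal_norm)
    then have "\<phi> (outer a) = \<phi> (outer a')" using const[of c a] const[of c a'] c by simp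
    then show ?thesis by (simp add: a proj_def)
  next
    case 2
    then show ?thesis using Suc.prems by (simp add: proj_basis')
  next
    case 3
    have split: "\<exists>W b. A = insert b W \<and> b \<notin> W \<and> orthonormal W \<and> card W = m \<and> norm b = 1 \<and> (\<forall>w\<in>W. cip b w = 0)"
      if W: "orthonormal A" "card A = Suc m" for A :: "(complex, 'n) vec set"
    proof -
      obtain b W where "A = insert b W" "b \<notin> W" "card W = m"
        using W(2) by (auto simp: card_Suc_eq)
      then show ?thesis using W(1)
        by (intro exI[of _ W] exI[of _ b]) (auto simp: orthonormal_def cip_self_eq_1[symmetric])
    qed
    obtain W b where W: "A = insert b W" "b \<notin> W" "orthonormal W" "card W = m" "norm b = 1"
        "\<forall>w\<in>W. cip b w = 0"
      using split[of A] Suc.prems by auto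
    obtain W' b' where W': "A' = insert b' W'" "b' \<notin> W'" "orthonormal W'" "card W' = m" "norm b' = 1"
        "\<forall>w\<in>W'. cip b' w = 0"
      using split[of A'] Suc.prems by auto
    have "\<phi> (proj W + outer b) = \<phi> (proj W' + outer b')"
    proof (rule orthonormal_descent[of m \<phi>])
      show "\<phi> (proj W + outer b) = \<phi> (proj W + outer b')"
        if "orthonormal W" "card W = m" "norm b = 1" "norm b' = 1"
          "\<forall>w\<in>W. cip b w = 0" "\<forall>w\<in>W. cip b' w = 0" for W b b'
        using that 3 by (intro adjacent_projections[of m] Suc.IH) auto
    qed (use W W' 3 in auto)
    then show ?thesis using W W' by (simp add: proj_insert)
  qed
qed

lemma standard_frame: "frame (\<lambda>i :: 'n. axis i (1 :: complex))"
proof -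
  have "cip (axis i 1) y = cnj (y $ i)" for i :: 'n and y
  proof -
    have "cip (axis i 1) y = (\<Sum>k\<in>UNIV. if i = k then cnj (y $ k) else 0)"
      unfolding cip_def by (intro sum.cong) (auto simp: axis_def)
    then show ?thesis by simp
  qed
  then show ?thesis by (simp add: frame_def axis_def)
qed

text \<open>Indicators of final segments are increasing vectors, for which the position of every
  eigenvalue in the image is known; this pins \<open>\<sigma>\<close> down on them.\<close>

lemma final_segment_structure:
  assumes "frame u"
  shows "\<exists>T \<sigma>. invertible T
    \<and> (\<forall>d. increasing d \<longrightarrow> \<phi> (spec u d) = (\<Sum>k\<in>UNIV. d $ k *\<^sub>R cproj T {k}))
    \<and> (\<forall>S. \<phi> (proj (u ` S)) = cproj T (\<sigma> S)) \<and> (\<forall>S. card (\<sigma> S) = card S)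
    \<and> (\<forall>S S'. S \<subseteq> S' \<longrightarrow> \<sigma> S \<subseteq> \<sigma> S') \<and> (\<forall>k. \<sigma> {k..} = {k..}) \<and> (\<forall>k. \<sigma> {k<..} = {k<..})"
proof -
  obtain T \<sigma> where T: "invertible T"
    and inc: "\<forall>d. increasing d \<longrightarrow> \<phi> (spec u d) = T ** diag_mat (\<lambda>i. of_real (d $ i)) ** matrix_inv T"
    and \<sigma>: "\<forall>S. \<phi> (proj (u ` S)) = cproj T (\<sigma> S)" "\<forall>S. card (\<sigma> S) = card S"
      "\<forall>S S'. S \<subseteq> S' \<longrightarrow> \<sigma> S \<subseteq> \<sigma> S'"
    using frame_structure[OF assms] by auto
  have seg: "\<sigma> S = S" if "\<And>i j. i \<le> j \<Longrightarrow> i \<in> S \<Longrightarrow> j \<in> S" for S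
  proof -
    have "increasing (\<chi> i. of_bool (i \<in> S))" using that by (auto simp: increasing_def)
    then have "\<phi> (proj (u ` S)) = cproj T S"
      using inc[rule_format, of "\<chi> i. of_bool (i \<in> S)"] spec_indicator[OF assms, of S]
      by (simp add: cproj_def of_bool_def if_distrib[of complex_of_real] cong: if_cong)
    then show ?thesis using \<sigma>(1) by (simp add: cproj_inject[OF T])
  qed
  have "\<sigma> {k..} = {k..}" "\<sigma> {k<..} = {k<..}" for k by (rule seg, force)+
  then show ?thesis using T inc \<sigma> by (intro exI[of _ T] exI[of _ \<sigma>]) (simp add: conj_diag_sum)
qed

lemma cproj_singleton: "cproj T {k} = cproj T {k..} - cproj T {k<..}" for k :: 'n
proof -
  have "{k..} = {k} \<union> {k<..}" by auto
  then have "cproj T {k..} = cproj T {k} + cproj T {k<..}" using cproj_union[of "{k}" "{k<..}"] by simp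
  then show ?thesis by simp
qed

lemma sorted_form:
  assumes n: "CARD('n) \<ge> 3"
    and const: "\<And>a b. norm a = 1 \<Longrightarrow> norm b = 1 \<Longrightarrow> cip a b = 0 \<Longrightarrow> \<phi> (outer a) = \<phi> (outer b)"
  shows "\<exists>T. invertible T \<and>
    (\<forall>X\<in>self_adjoint_matrices. \<phi> X = T ** sorted_eigenvalue_diag X ** matrix_inv T)"
proof -
  define u0 :: "'n \<Rightarrow> (complex, 'n) vec" where "u0 i = axis i 1" for i
  have u0: "frame u0" unfolding u0_def[abs_def] by (rule standard_frame)
  obtain T0 \<sigma>0 where T0: "invertible T0" "\<forall>S. \<phi> (proj (u0 ` S)) = cproj T0 (\<sigma>0 S)"
    "\<forall>k. \<sigma>0 {k..} = {k..}" "\<forall>k. \<sigma>0 {k<..} = {k<..}"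
    using final_segment_structure[OF u0] by auto
  have "\<phi> X = T0 ** sorted_eigenvalue_diag X ** matrix_inv T0" if H: "X \<in> self_adjoint_matrices" for X
  proof -
    obtain u d where ud: "frame u" "increasing d" "X = spec u d" using spectral_theorem[OF H] by auto
    obtain T \<sigma> where T: "invertible T" "\<forall>S. \<phi> (proj (u ` S)) = cproj T (\<sigma> S)"
      "\<forall>k. \<sigma> {k..} = {k..}" "\<forall>k. \<sigma> {k<..} = {k<..}"
      and X: "\<phi> X = (\<Sum>k\<in>UNIV. d $ k *\<^sub>R cproj T {k})"
      using final_segment_structure[OF ud(1)] ud by auto
    have "\<phi> (proj (u ` S)) = \<phi> (proj (u0 ` S))" for S
    proof (rule constant_on_projections[OF n const])
      show "card (u ` S) = card S" "card (u0 ` S) = card S"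
        using frame_inj[OF ud(1)] frame_inj[OF u0] by (auto intro!: card_image simp: inj_on_def inj_def)
      show "card S \<le> CARD('n)" by (intro card_mono) auto
    qed (auto intro: frame_orthonormal u0 ud(1))
    \<comment> \<open>T and T0 may differ, but their idempotents for a final segment are images of
      projections of equal rank and hence agree; differences of consecutive segments give the
      singletons.\<close>
    then have "cproj T {k} = cproj T0 {k}" for k
      using T T0 by (metis cproj_singleton)
    then show ?thesis
      using X by (simp add: sorted_eigenvalue_diag_eq ud eigenvalue_vec_spec conj_diag_sum)
  qed
  then show ?thesis using T0(1) by auto
qed

section \<open>The case of annihilating images\<close>

lemma orthogonal_form:
  assumes orth: "\<And>a b. norm a = 1 \<Longrightarrow> norm b = 1 \<Longrightarrow> cip a b = 0 \<Longrightarrow> \<phi> (outer a) ** \<phi> (outer b) = 0"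
    and u: "frame u"
  shows "\<exists>T. invertible T \<and> (\<forall>k. \<phi> (outer (u k)) = cproj T {k}) \<and>
    (\<forall>d. increasing d \<longrightarrow> \<phi> (spec u d) = (\<Sum>k\<in>UNIV. d $ k *\<^sub>R \<phi> (outer (u k))))"
proof -
  obtain T \<sigma> where T: "invertible T" "\<And>S. \<phi> (proj (u ` S)) = cproj T (\<sigma> S)"
      "\<And>S. card (\<sigma> S) = card S" "\<And>S S'. S \<subseteq> S' \<Longrightarrow> \<sigma> S \<subseteq> \<sigma> S'"
      "\<And>k. \<sigma> {k..} = {k..}" "\<And>k. \<sigma> {k<..} = {k<..}"
    and X: "\<And>d. increasing d \<Longrightarrow> \<phi> (spec u d) = (\<Sum>k\<in>UNIV. d $ k *\<^sub>R cproj T {k})"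
    using final_segment_structure[OF u] by auto
  have f: "\<phi> (outer (u k)) = cproj T (\<sigma> {k})" for k
    using T(2)[of "{k}"] by (simp add: proj_def)
  have zero: "cproj T {} = 0" by (simp add: cproj_def diag_mat_def zero_vec_def[symmetric])
  have disj: "\<sigma> {i} \<inter> \<sigma> {j} = {}" if "i \<noteq> j" for i j
  proof -
    have "\<phi> (outer (u i)) ** \<phi> (outer (u j)) = 0"
      using that u by (intro orth) (auto simp: frame_norm frame_def)
    then have "cproj T (\<sigma> {i} \<inter> \<sigma> {j}) = cproj T {}" by (simp add: f cproj_mult[OF T(1)] zero)
    then show ?thesis by (simp add: cproj_inject[OF T(1)])
  qed
  \<comment> \<open>The sets \<open>\<sigma> {k}\<close> with k in S are disjoint one-element
    subsets of \<open>\<sigma> S\<close>, and the sizes match.\<close>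
  have union: "\<sigma> S = (\<Union>k\<in>S. \<sigma> {k})" for S
  proof (rule card_subset_eq[symmetric])
    show "(\<Union>k\<in>S. \<sigma> {k}) \<subseteq> \<sigma> S" by (intro UN_least T(4)) auto
    have "card (\<Union>k\<in>S. \<sigma> {k}) = (\<Sum>k\<in>S. card (\<sigma> {k}))"
      using disj by (intro card_UN_disjoint) auto
    then show "card (\<Union>k\<in>S. \<sigma> {k}) = card (\<sigma> S)" by (simp add: T(3))
  qed simp
  have "\<sigma> {k} = {k}" for k
  proof -
    \<comment> \<open>\<open>\<sigma>\<close> fixes both \<open>{k..}\<close> and
      \<open>{k<..}\<close>, which differ by k only, so the set added by k must be
      \<open>{k}\<close>.\<close>
    have seg: "{k..} = insert k {k<..}" by auto
    have "\<sigma> (insert k {k<..}) = \<sigma> {k} \<union> \<sigma> {k<..}"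
      unfolding union[of "insert k {k<..}"] union[of "{k<..}"] by simp
    then have "insert k {k<..} = \<sigma> {k} \<union> {k<..}" using T(5,6)[of k] by (simp add: seg)
    moreover have "\<sigma> {k} \<inter> {k<..} = {}"
    proof -
      have "\<sigma> {k} \<inter> (\<Union>j\<in>{k<..}. \<sigma> {j}) = {}"
        unfolding Int_UN_distrib UNION_empty_conv by (intro ballI disj) auto
      then show ?thesis using union[of "{k<..}"] T(6)[of k] by simp
    qed
    moreover have "k \<notin> {k<..}" by simp
    ultimately show ?thesis by blast
  qed
  then show ?thesis using T(1) X f by (intro exI[of _ T]) simp
qed

end

section \<open>Orthogonality-preserving maps into rank-one idempotents\<close>

lemma sum_two:
  fixes g :: "'n::finite \<Rightarrow> complex"
  assumes "i \<noteq> j" "\<And>k. k \<noteq> i \<Longrightarrow> k \<noteq> j \<Longrightarrow> g k = 0"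
  shows "sum g UNIV = g i + g j"
proof -
  have "sum g UNIV = sum g {i, j}" by (rule sum.mono_neutral_right) (use assms in auto)
  then show ?thesis using assms(1) by simp
qed

lemma sum_three:
  fixes g :: "'n::finite \<Rightarrow> complex"
  assumes "i \<noteq> j" "i \<noteq> k" "j \<noteq> k" "\<And>l. l \<noteq> i \<Longrightarrow> l \<noteq> j \<Longrightarrow> l \<noteq> k \<Longrightarrow> g l = 0"
  shows "sum g UNIV = g i + g j + g k"
proof -
  have "sum g UNIV = sum g {i, j, k}" by (rule sum.mono_neutral_right) (use assms in auto)
  then show ?thesis using assms(1-3) by (simp add: add_ac)
qed

definition vec2 :: "'n::finite \<Rightarrow> 'n \<Rightarrow> complex \<Rightarrow> complex \<Rightarrow> complex^'n" where
  "vec2 i j a b = (\<chi> l. if l = i then a else if l = j then b else 0)"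

definition vec3 :: "'n::finite \<Rightarrow> 'n \<Rightarrow> 'n \<Rightarrow> complex \<Rightarrow> complex \<Rightarrow> complex \<Rightarrow> complex^'n" where
  "vec3 i j k a b c = (\<chi> l. if l = i then a else if l = j then b else if l = k then c else 0)"

lemma vec2_nz: "a \<noteq> 0 \<or> (b \<noteq> 0 \<and> i \<noteq> j) \<Longrightarrow> vec2 i j a b \<noteq> 0"
  by (auto simp: vec2_def vec_eq_iff)

lemma vec2_one_nz [simp]: "vec2 i j 1 b \<noteq> 0"
  by (simp add: vec2_nz)

lemma vec3_nz: "a \<noteq> 0 \<Longrightarrow> vec3 i j k a b c \<noteq> 0"
  by (auto simp: vec3_def vec_eq_iff)

lemma vec2_scale: "a \<noteq> 0 \<Longrightarrow> vec2 i j a b = a *s vec2 i j 1 (b / a)"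
  by (auto simp: vec2_def vec_eq_iff)

lemma vec2_axis: "vec2 i j 1 0 = axis i 1"
  by (auto simp: vec2_def vec_eq_iff axis_def)

lemma cip_axis: "cip x (axis i 1) = x $ i"
proof -
  have "cip x (axis i 1) = (\<Sum>k\<in>UNIV. if k = i then x $ k else 0)"
    unfolding cip_def by (intro sum.cong) (auto simp: axis_def)
  then show ?thesis by simp
qed

lemma cip_vec2: "i \<noteq> j \<Longrightarrow> cip x (vec2 i j a b) = x $ i * cnj a + x $ j * cnj b"
  unfolding cip_def by (subst sum_two[of i j]) (auto simp: vec2_def)

lemma cip_vec3:
  assumes "i \<noteq> j" "i \<noteq> k" "j \<noteq> k"
  shows "cip x (vec3 i j k a b c) = x $ i * cnj a + x $ j * cnj b + x $ k * cnj c"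
  unfolding cip_def by (subst sum_three[OF assms]) (use assms in \<open>auto simp: vec3_def\<close>)

text \<open>Entrywise properties of the map from x to the idempotent of the line through x, in a
  basis where the axes have the standard idempotents as images. \<open>rank1\<close> says that all
  two-by-two minors vanish, and \<open>orth\<close> that a matrix product is 0.\<close>

locale proj_map =
  fixes f :: "(complex, 'n::finite) vec \<Rightarrow> 'n cmatrix"
  assumes dim3: "CARD('n) \<ge> 3"
    and rank1: "x \<noteq> 0 \<Longrightarrow> f x $ i $ j * f x $ k $ l = f x $ i $ l * f x $ k $ j"
    and trace1: "x \<noteq> 0 \<Longrightarrow> (\<Sum>i\<in>UNIV. f x $ i $ i) = 1"
    and scale: "x \<noteq> 0 \<Longrightarrow> c \<noteq> 0 \<Longrightarrow> f (c *s x) = f x"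
    and orth: "x \<noteq> 0 \<Longrightarrow> y \<noteq> 0 \<Longrightarrow> cip x y = 0 \<Longrightarrow> (\<Sum>k\<in>UNIV. f x $ i $ k * f y $ k $ j) = 0"
    and cont: "continuous_on {x. x \<noteq> 0} f"
    and axis: "f (axis i 1) $ j $ k = (if j = i \<and> k = i then 1 else 0)"
begin

lemma third_index: "\<exists>k. k \<noteq> i \<and> k \<noteq> j" for i j :: 'n
proof (rule ccontr)
  assume "\<not> ?thesis"
  then have "UNIV \<subseteq> {i, j}" by auto
  then have "CARD('n) \<le> card {i, j}" by (intro card_mono) auto
  also have "\<dots> \<le> 2" by (simp add: card_insert_if)
  finally show False using dim3 by simp
qed

text \<open>x is orthogonal to the i-th axis, whose image is the matrix unit at (i, i);
  multiplication by it on either side extracts a column or a row.\<close>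

lemma support:
  assumes "x \<noteq> 0" "x $ i = 0"
  shows "f x $ j $ i = 0" "f x $ i $ j = 0"
proof -
  have a: "axis i 1 \<noteq> (0 :: (complex, 'n) vec)" by (simp add: axis_eq_0_iff)
  have "(\<Sum>k\<in>UNIV. f x $ j $ k * f (axis i 1) $ k $ i) = 0"
    by (rule orth) (use assms a in \<open>auto simp: cip_axis\<close>)
  moreover have "(\<Sum>k\<in>UNIV. f x $ j $ k * f (axis i 1) $ k $ i) = (\<Sum>k\<in>UNIV. if k = i then f x $ j $ k else 0)"
    by (intro sum.cong) (auto simp: axis)
  ultimately show "f x $ j $ i = 0" by simp
  have "(\<Sum>k\<in>UNIV. f (axis i 1) $ i $ k * f x $ k $ j) = 0"
    by (rule orth) (use assms a in \<open>auto simp: cip_eq_0_commute[of _ x] cip_axis\<close>)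
  moreover have "(\<Sum>k\<in>UNIV. f (axis i 1) $ i $ k * f x $ k $ j) = (\<Sum>k\<in>UNIV. if k = i then f x $ k $ j else 0)"
    by (intro sum.cong) (auto simp: axis)
  ultimately show "f x $ i $ j = 0" by simp
qed

lemma vec2_support:
  assumes "a \<noteq> 0 \<or> b \<noteq> 0" "i \<noteq> j" "k \<noteq> i" "k \<noteq> j"
  shows "f (vec2 i j a b) $ l $ k = 0" "f (vec2 i j a b) $ k $ l = 0"
  using support[of "vec2 i j a b" k l] assms vec2_nz[of a b i j] by (auto simp: vec2_def)

lemma vec2_trace:
  assumes "a \<noteq> 0 \<or> b \<noteq> 0" "i \<noteq> j"
  shows "f (vec2 i j a b) $ i $ i + f (vec2 i j a b) $ j $ j = 1"
  using trace1[of "vec2 i j a b"] sum_two[of i j "\<lambda>k. f (vec2 i j a b) $ k $ k"]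
    vec2_support[of a b i j] vec2_nz[of a b i j] assms by auto

text \<open>A vector of the plane of the two axes orthogonal to both arguments forces the proportionality.\<close>

lemma proportional:
  assumes x: "x \<noteq> 0" and ij: "i \<noteq> j" and nz: "x $ i \<noteq> 0 \<or> x $ j \<noteq> 0"
  defines "u \<equiv> vec2 i j (x $ i) (x $ j)"
  shows "f x $ i $ s * f u $ j $ t = f x $ j $ s * f u $ i $ t"
    and "f x $ s $ i * f u $ t $ j = f x $ s $ j * f u $ t $ i"
proof -
  define y where "y = vec2 i j (cnj (x $ j)) (- cnj (x $ i))"
  have y: "y \<noteq> 0" and u: "u \<noteq> 0" unfolding y_def u_def using nz ij by (auto intro!: vec2_nz)
  have xy: "cip x y = 0" "cip u y = 0"
    using ij by (simp_all add: y_def cip_vec2) (simp add: u_def vec2_def)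
  have supp: "f y $ l $ k = 0" "f y $ k $ l = 0" if "k \<noteq> i" "k \<noteq> j" for k l
    unfolding y_def by (rule vec2_support; use that ij nz in auto)+
  have tr: "f y $ i $ i + f y $ j $ j = 1" unfolding y_def using ij nz by (intro vec2_trace) auto
  have left: "f y $ a $ i * f v $ i $ t + f y $ a $ j * f v $ j $ t = 0" if "v \<noteq> 0" "cip v y = 0" for v a t
  proof -
    have "(\<Sum>k\<in>UNIV. f y $ a $ k * f v $ k $ t) = 0"
      by (rule orth) (use that y in \<open>auto simp: cip_eq_0_commute[of y]\<close>)
    then show ?thesis using sum_two[OF ij, of "\<lambda>k. f y $ a $ k * f v $ k $ t"] supp by simp
  qed
  have right: "f v $ t $ i * f y $ i $ a + f v $ t $ j * f y $ j $ a = 0" if "v \<noteq> 0" "cip v y = 0" for v a t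
  proof -
    have "(\<Sum>k\<in>UNIV. f v $ t $ k * f y $ k $ a) = 0"
      by (rule orth) (use that y in auto)
    then show ?thesis using sum_two[OF ij, of "\<lambda>k. f v $ t $ k * f y $ k $ a"] supp by simp
  qed
  \<comment> \<open>Two pairs annihilated by the same nonzero pair (p, q) are proportional.\<close>
  have alg: "X * V = Y * U" if "p * X + q * Y = 0" "p * U + q * V = 0" "p \<noteq> 0 \<or> q \<noteq> 0"
    for p q X Y U V :: complex
  proof (cases "p = 0")
    case True
    then show ?thesis using that by simp
  next
    case False
    have "p * (X * V - Y * U) = (p * X + q * Y) * V - (p * U + q * V) * Y" by (simp add: algebra_simps)
    then show ?thesis using that False by simp
  qed
  obtain a where a: "f y $ a $ i \<noteq> 0 \<or> f y $ a $ j \<noteq> 0" using tr by force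
  show "f x $ i $ s * f u $ j $ t = f x $ j $ s * f u $ i $ t"
    by (rule alg[OF left[OF x xy(1), of a] left[OF u xy(2), of a] a])
  obtain b where b: "f y $ i $ b \<noteq> 0 \<or> f y $ j $ b \<noteq> 0" using tr by force
  show "f x $ s $ i * f u $ t $ j = f x $ s $ j * f u $ t $ i"
    by (rule alg[of "f y $ i $ b" _ "f y $ j $ b"])
      (use right[OF x xy(1), of s b] right[OF u xy(2), of t b] b in \<open>simp_all add: mult.commute\<close>)
qed

text \<open>The coordinate z runs through the lines in the plane of the axes i and j (for distinct i
  and j), except the j-th axis.\<close>

definition E where "E i j z = f (vec2 i j 1 z)"

lemma vec2_E: "a \<noteq> 0 \<Longrightarrow> f (vec2 i j a b) = E i j (b / a)"
  unfolding E_def by (subst vec2_scale) (auto intro!: scale vec2_nz)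

lemma E_zero: "E i j 0 $ a $ b = (if a = i \<and> b = i then 1 else 0)"
  by (simp add: E_def vec2_axis axis)

lemma E_trace: "i \<noteq> j \<Longrightarrow> E i j z $ j $ j = 1 - E i j z $ i $ i"
  using vec2_trace[of 1 z i j] by (simp add: E_def eq_diff_eq add.commute)

lemma continuous_E: "continuous_on A (\<lambda>z. E i j (g z) $ a $ b)" if "continuous_on A g"
proof -
  have "continuous_on A (\<lambda>z. vec2 i j 1 (g z))"
    unfolding vec2_def
  proof (rule continuous_on_vec_lambda)
    show "continuous_on A (\<lambda>z. if l = i then 1 else if l = j then g z else 0)" for l
      using that by (cases "l = i"; cases "l = j") auto
  qed
  then show ?thesis unfolding E_def
    by (intro continuous_on_component continuous_on_compose2[OF cont]) auto
qed

text \<open>With u the part of x in the coordinates i and j, both proportionalities contain the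
  product \<open>f x $ j $ i * f u $ i $ j\<close>. Eliminating it compares the diagonal entries of
  f x with those of E, whose sum is 1.\<close>

lemma diagonal_relation:
  assumes "x \<noteq> 0" "i \<noteq> j" "x $ i \<noteq> 0"
  shows "f x $ i $ i * (1 - E i j (x $ j / x $ i) $ i $ i) = f x $ j $ j * E i j (x $ j / x $ i) $ i $ i"
  using proportional(1)[of x i j i j] proportional(2)[of x i j j i] assms
    E_trace[of i j "x $ j / x $ i"]
  by (simp add: vec2_E)

text \<open>If the entry were always 1, the one at j would be 0 and a vanishing minor would make the
  product of the off-diagonal entries 0 at z = 1. But (1, 1) and (1, -1) are orthogonal in either
  order, which makes these entries nonzero.\<close>

lemma E_diag_not_constant_one:
  assumes ij: "i \<noteq> j" shows "\<exists>z. E i j z $ i $ i \<noteq> 1"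
proof (rule ccontr)
  assume "\<not> ?thesis"
  then have one: "E i j z $ i $ i = 1" for z by auto
  have zero: "E i j z $ j $ j = 0" for z using one E_trace[OF ij] by simp
  have prod: "E i j z $ i $ j * E i j z $ j $ i = 0" for z
    using rank1[of "vec2 i j 1 z" i i j j] zero[of z] by (auto simp: E_def vec2_nz)
  have sum: "E i j z $ i $ i * E i j w $ i $ i + E i j z $ i $ j * E i j w $ j $ i = 0"
    if "1 + z * cnj w = 0" for z w
  proof -
    have "(\<Sum>k\<in>UNIV. f (vec2 i j 1 z) $ i $ k * f (vec2 i j 1 w) $ k $ i) = 0"
    proof (rule orth)
      show "cip (vec2 i j 1 z) (vec2 i j 1 w) = 0"
        unfolding cip_vec2[OF ij] using that ij by (auto simp: vec2_def)
    qed auto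
    then show ?thesis
      using sum_two[OF ij, of "\<lambda>k. f (vec2 i j 1 z) $ i $ k * f (vec2 i j 1 w) $ k $ i"]
        vec2_support[of 1 w i j] ij by (simp add: E_def)
  qed
  show False using sum[of 1 "-1"] sum[of "-1" 1] prod[of 1] prod[of "-1"] one by auto
qed

text \<open>With \<open>A\<close>, \<open>B\<close>, \<open>C\<close> the leading diagonal entries for the index pairs \<open>ij\<close>, \<open>jk\<close>, \<open>ik\<close>,
  a vector with coordinates \<open>(1, z, z w)\<close> shows that \<open>A z = 0\<close> forces \<open>B w = 1\<close> or \<open>C (z w) = 0\<close>,
  and that \<open>B w = 1\<close> forces \<open>C (z w) = 1\<close> or \<open>A z = 0\<close>. Boundary points of the two sets
  \<open>{z. A z = 0}\<close> and \<open>{w. B w = 1}\<close> would then yield a point where \<open>C\<close> is both 0 and 1.\<close>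

lemma E_diag_nz:
  assumes ij: "i \<noteq> j" shows "E i j z $ i $ i \<noteq> 0"
proof
  assume z: "E i j z $ i $ i = 0"
  obtain k where k: "k \<noteq> i" "k \<noteq> j" using third_index by blast
  define A B C where "A z = E i j z $ i $ i" and "B z = E j k z $ j $ j" and "C z = E i k z $ i $ i" for z
  \<comment> \<open>p, q and r are the diagonal entries at i, j and k of the image of (1, z, z w);
    the other diagonal entries vanish.\<close>
  have rel: "\<exists>p q r. p + q + r = 1 \<and> p * (1 - A z) = q * A z \<and> q * (1 - B w) = r * B w
      \<and> p * (1 - C (z * w)) = r * C (z * w)" if z: "z \<noteq> 0" for z w
  proof -
    define x where "x = vec3 i j k 1 z (z * w)"
    have x: "x \<noteq> 0" "x $ i = 1" "x $ j = z" "x $ k = z * w" and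
      supp: "\<And>l. l \<noteq> i \<Longrightarrow> l \<noteq> j \<Longrightarrow> l \<noteq> k \<Longrightarrow> x $ l = 0"
      using ij k by (auto simp: x_def vec3_nz) (auto simp: vec3_def)
    have "f x $ i $ i + f x $ j $ j + f x $ k $ k = 1"
      using trace1[OF x(1)] sum_three[of i j k "\<lambda>l. f x $ l $ l"] support(1)[OF x(1)] supp ij k by simp
    then show ?thesis
      using diagonal_relation[OF x(1), of i j] diagonal_relation[OF x(1), of j k]
        diagonal_relation[OF x(1), of i k] ij k x z unfolding A_def B_def C_def
      by (intro exI[of _ "f x $ i $ i"] exI[of _ "f x $ j $ j"] exI[of _ "f x $ k $ k"]) auto
  qed
  have F1: "B w = 1 \<or> C (z * w) = 0" if "z \<noteq> 0" "A z = 0" for z w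
    using rel[OF that(1), of w] that(2) by auto
  have F2: "C (z * w) = 1 \<or> A z = 0" if z: "z \<noteq> 0" and B: "B w = 1" for z w
  proof -
    obtain p q r where "p + q + r = 1" "p * (1 - A z) = q * A z" "q * (1 - B w) = r * B w"
      "p * (1 - C (z * w)) = r * C (z * w)" using rel[OF z, of w] by auto
    then show ?thesis using B by auto
  qed
  have zero: "A 0 = 1" "B 0 = 1" "C 0 = 1" by (simp_all add: A_def B_def C_def E_zero)
  have cA: "continuous_on UNIV A" and cB: "continuous_on UNIV B"
    and cC: "continuous_on UNIV (\<lambda>z. C (z * c))" "continuous_on UNIV (\<lambda>z. C (c * z))" for c
    unfolding A_def[abs_def] B_def[abs_def] C_def
    by (auto intro!: continuous_E continuous_on_mult continuous_on_id continuous_on_const)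
  define S where "S = {w. B w = 1}"
  define Z where "Z = {z. A z = 0}"
  have clS: "closed S" and clZ: "closed Z" unfolding S_def Z_def
    by (intro closed_Collect_eq cA cB continuous_on_const)+
  have "0 \<in> S" using zero by (simp add: S_def)
  moreover have "S \<noteq> UNIV" using E_diag_not_constant_one[of j k] k by (auto simp: S_def B_def)
  ultimately have "frontier S \<noteq> {}" by (intro frontier_not_empty) auto
  then obtain w0 where w0: "w0 \<in> S" "w0 \<in> closure (- S)"
    using clS by (auto simp: frontier_closures)
  have "z \<in> Z" using z by (simp add: Z_def A_def)
  moreover have "0 \<notin> Z" using zero by (simp add: Z_def)
  ultimately have "frontier Z \<noteq> {}" by (intro frontier_not_empty) auto
  then obtain z0 where z0: "z0 \<in> Z" "z0 \<in> closure (- Z)"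
    using clZ by (auto simp: frontier_closures)
  have z0nz: "z0 \<noteq> 0" using z0(1) \<open>0 \<notin> Z\<close> by auto
  \<comment> \<open>C vanishes at \<open>z0 * w\<close> for w outside S, hence by closedness also
    for the boundary point \<open>w0\<close>. The value 1 at \<open>z0 * w0\<close> is reached in
    the same way from outside Z.\<close>
  have "closed {w. C (z0 * w) = 0}" by (intro closed_Collect_eq cC continuous_on_const)
  moreover have "- S \<subseteq> {w. C (z0 * w) = 0}" using F1[OF z0nz] z0(1) by (auto simp: S_def Z_def)
  ultimately have "w0 \<in> {w. C (z0 * w) = 0}" using w0(2) closure_minimal by blast
  moreover have "closed {z. C (z * w0) = 1}" by (intro closed_Collect_eq cC continuous_on_const)
  moreover have "- Z \<subseteq> {z. C (z * w0) = 1}"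
  proof
    fix z assume "z \<in> - Z"
    then show "z \<in> {z. C (z * w0) = 1}"
      using F2[of z w0] w0(1) zero by (cases "z = 0") (auto simp: S_def Z_def)
  qed
  ultimately have "z0 \<in> {z. C (z * w0) = 1}" "C (z0 * w0) = 0" using z0(2) closure_minimal by blast+
  then show False by simp
qed

text \<open>Writing a rank-one matrix f x as a column times a row, G and K are the ratios of the
  j-th to the i-th coordinate of the column and of the row, as functions of
  \<open>x $ j / x $ i\<close>.\<close>

definition G where "G i j z = E i j z $ j $ i / E i j z $ i $ i"
definition K where "K i j z = E i j z $ i $ j / E i j z $ i $ i"

lemma rows: "x \<noteq> 0 \<Longrightarrow> x $ i \<noteq> 0 \<Longrightarrow> i \<noteq> j \<Longrightarrow> f x $ j $ s = G i j (x $ j / x $ i) * f x $ i $ s"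
  using proportional(1)[of x i j s i] E_diag_nz[of i j "x $ j / x $ i"]
  by (simp add: vec2_E G_def field_simps)

lemma columns: "x \<noteq> 0 \<Longrightarrow> x $ i \<noteq> 0 \<Longrightarrow> i \<noteq> j \<Longrightarrow> f x $ s $ j = K i j (x $ j / x $ i) * f x $ s $ i"
  using proportional(2)[of x i j s i] E_diag_nz[of i j "x $ j / x $ i"]
  by (simp add: vec2_E K_def field_simps)

text \<open>A zero at (i, i) would spread through \<open>rows\<close> and \<open>columns\<close> to
  the entire diagonal, against trace 1.\<close>

lemma diag_nz: "x \<noteq> 0 \<Longrightarrow> x $ i \<noteq> 0 \<Longrightarrow> f x $ i $ i \<noteq> 0"
proof
  assume x: "x \<noteq> 0" "x $ i \<noteq> 0" and 0: "f x $ i $ i = 0"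
  have "f x $ j $ j = 0" for j
  proof (cases "i = j")
    case False
    have "f x $ j $ i = 0" unfolding rows[OF x False, of i] by (simp add: 0)
    then show ?thesis unfolding columns[OF x False, of j] by simp
  qed (use 0 in simp)
  then show False using trace1[OF x(1)] by simp
qed

lemma G_zero [simp]: "i \<noteq> j \<Longrightarrow> G i j 0 = 0" and K_zero [simp]: "i \<noteq> j \<Longrightarrow> K i j 0 = 0"
  by (auto simp: G_def K_def E_zero)

lemma G_inverse:
  assumes "i \<noteq> j" "z \<noteq> 0" shows "G i j z * G j i (1 / z) = 1"
proof -
  define x where "x = vec2 i j 1 z"
  have x: "x \<noteq> 0" "x $ i = 1" "x $ j = z" using assms by (auto simp: x_def vec2_nz) (auto simp: vec2_def)
  have a: "f x $ j $ i = G i j z * f x $ i $ i" using rows[OF x(1), of i j i] x assms by simp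
  have b: "f x $ i $ i = G j i (1 / z) * f x $ j $ i" using rows[OF x(1), of j i i] x assms by simp
  have "(G i j z * G j i (1 / z)) * f x $ i $ i = 1 * f x $ i $ i"
    using b[unfolded a] by (simp only: mult.commute mult.left_commute mult_1_left)
  moreover have "f x $ i $ i \<noteq> 0" using diag_nz[OF x(1)] x by simp
  ultimately show ?thesis by (simp only: mult_cancel_right) simp
qed

lemma G_nz: "i \<noteq> j \<Longrightarrow> z \<noteq> 0 \<Longrightarrow> G i j z \<noteq> 0"
  using G_inverse by force

text \<open>For the vector (1, z, z w), passing from coordinate i to k directly or through j gives
  the same ratio. This cocycle law is the source of multiplicativity.\<close>

lemma G_K_mult:
  assumes "i \<noteq> j" "i \<noteq> k" "j \<noteq> k"
  shows "G i k (z * w) = G i j z * G j k w" and "K i k (z * w) = K i j z * K j k w"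
proof -
  have "G i k (z * w) = G i j z * G j k w \<and> K i k (z * w) = K i j z * K j k w"
  proof (cases "z = 0")
    case False
    define x where "x = vec3 i j k 1 z (z * w)"
    have x: "x \<noteq> 0" "x $ i = 1" "x $ j = z" "x $ k = z * w"
      using assms by (auto simp: x_def vec3_nz) (auto simp: vec3_def)
    have nz: "f x $ i $ i \<noteq> 0" using diag_nz[OF x(1)] x by simp
    have "f x $ k $ i = G i k (z * w) * f x $ i $ i" "f x $ k $ i = G j k w * f x $ j $ i"
        "f x $ j $ i = G i j z * f x $ i $ i"
      using rows[OF x(1), of i k i] rows[OF x(1), of j k i] rows[OF x(1), of i j i] x assms False
      by simp_all
    then have "G i k (z * w) * f x $ i $ i = (G i j z * G j k w) * f x $ i $ i"
      by (simp only: mult.commute mult.left_commute)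
    moreover have "f x $ i $ k = K i k (z * w) * f x $ i $ i" "f x $ i $ k = K j k w * f x $ i $ j"
        "f x $ i $ j = K i j z * f x $ i $ i"
      using columns[OF x(1), of i k i] columns[OF x(1), of j k i] columns[OF x(1), of i j i] x assms False
      by simp_all
    then have "K i k (z * w) * f x $ i $ i = (K i j z * K j k w) * f x $ i $ i"
      by (simp only: mult.commute mult.left_commute)
    ultimately show ?thesis using nz by (simp only: mult_cancel_right) simp
  qed (use assms in auto)
  then show "G i k (z * w) = G i j z * G j k w" "K i k (z * w) = K i j z * K j k w" by auto
qed

end

section \<open>The function of the coordinate ratios is the identity or the conjugation\<close>

locale normalized_proj_map = proj_map f for f :: "(complex, 'n::finite) vec \<Rightarrow> 'n cmatrix" +
  assumes G_one: "i \<noteq> j \<Longrightarrow> G i j 1 = 1"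
begin

text \<open>A cocycle factor taken at 1 is 1, so a single index can be exchanged at a time; an index
  k different from i and i' serves as intermediate second index.\<close>

lemma G_indep:
  assumes "i \<noteq> j" "i' \<noteq> j'" shows "G i j z = G i' j' z"
proof -
  have snd: "G i j z = G i k z" if "i \<noteq> j" "i \<noteq> k" for i j k
    using G_K_mult(1)[of i j k z 1] G_one[of j k] that by (cases "j = k") auto
  have fst: "G i j z = G k j z" if "i \<noteq> j" "k \<noteq> j" for i j k
    using G_K_mult(1)[of i k j 1 z] G_one[of i k] that by (cases "i = k") auto
  obtain k where "k \<noteq> i" "k \<noteq> i'" using third_index by blast
  then have "G i j z = G i k z" "G i k z = G i' k z" "G i' k z = G i' j' z"
    using assms by (auto intro: snd fst)
  then show ?thesis by simp
qed

definition g where "g z = G (SOME i. True) (SOME j. j \<noteq> (SOME i. True)) z"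

lemma G_eq: "i \<noteq> j \<Longrightarrow> G i j z = g z"
proof -
  assume ij: "i \<noteq> j"
  let ?i = "SOME i :: 'n. True"
  have "\<exists>j. j \<noteq> ?i" using third_index by blast
  then have "(SOME j. j \<noteq> ?i) \<noteq> ?i" by (rule someI_ex)
  then show ?thesis unfolding g_def by (intro G_indep[OF ij]) auto
qed

lemma three_indices: "\<exists>i j k :: 'n. i \<noteq> j \<and> i \<noteq> k \<and> j \<noteq> k"
proof -
  obtain j where "j \<noteq> (undefined :: 'n)" using third_index by blast
  moreover obtain k where "k \<noteq> undefined" "k \<noteq> j" using third_index by blast
  ultimately show ?thesis by blast
qed

lemma g_mult: "g (z * w) = g z * g w"
proof -
  obtain i j k :: 'n where "i \<noteq> j" "i \<noteq> k" "j \<noteq> k" using three_indices by blast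
  then show ?thesis using G_K_mult(1)[of i j k z w] by (simp add: G_eq)
qed

lemma g_zero [simp]: "g 0 = 0" and g_one [simp]: "g 1 = 1" and g_nz: "z \<noteq> 0 \<Longrightarrow> g z \<noteq> 0"
proof -
  obtain i j k :: 'n where ij: "i \<noteq> j" "i \<noteq> k" "j \<noteq> k" using three_indices by blast
  show "g 0 = 0" using G_zero[OF ij(1)] by (simp add: G_eq[OF ij(1)])
  show "g 1 = 1" using G_one[OF ij(1)] by (simp add: G_eq[OF ij(1)])
  show "z \<noteq> 0 \<Longrightarrow> g z \<noteq> 0" using G_nz[OF ij(1)] by (simp add: G_eq[OF ij(1)])
qed

text \<open>(1, z) is orthogonal to (1, -1 / cnj z). The product of their images pairs a row with a
  column, which ties K at z to the inverse of g at -1 / cnj z.\<close>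

lemma K_eq_aux:
  assumes ij: "i \<noteq> j" and z: "z \<noteq> 0" shows "K i j z = - g (- cnj z)"
proof -
  define w where "w = - 1 / cnj z"
  have zw: "z * cnj w = - 1" using z by (simp add: w_def)
  have "(\<Sum>k\<in>UNIV. f (vec2 i j 1 z) $ i $ k * f (vec2 i j 1 w) $ k $ i) = 0"
  proof (rule orth)
    show "cip (vec2 i j 1 z) (vec2 i j 1 w) = 0"
      unfolding cip_vec2[OF ij] using zw ij by (auto simp: vec2_def)
  qed simp_all
  then have "E i j z $ i $ i * E i j w $ i $ i + E i j z $ i $ j * E i j w $ j $ i = 0"
    using sum_two[OF ij, of "\<lambda>k. f (vec2 i j 1 z) $ i $ k * f (vec2 i j 1 w) $ k $ i"]
      vec2_support[of 1 w i j] ij by (simp add: E_def)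
  then have "1 + K i j z * G i j w = 0"
    using E_diag_nz[OF ij, of z] E_diag_nz[OF ij, of w] by (simp add: K_def G_def field_simps)
  then have *: "K i j z * g w = - 1" using G_eq[OF ij] by (simp add: eq_neg_iff_add_eq_0 add.commute)
  have "g w * g (- cnj z) = 1" using z by (simp add: g_mult[symmetric] w_def)
  then have "K i j z = K i j z * (g w * g (- cnj z))" by simp
  also have "\<dots> = - g (- cnj z)" using * by (simp add: mult.assoc[symmetric])
  finally show ?thesis .
qed

text \<open>All \<open>K i j 1\<close> have the common value \<open>- g (- 1)\<close>; the cocycle
  law for K makes it equal to its square, which is g 1 = 1.\<close>

lemma g_minus_one: "g (- 1) = - 1"
proof -
  obtain i j k :: 'n where ij: "i \<noteq> j" "i \<noteq> k" "j \<noteq> k" using three_indices by blast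
  have K: "K a b 1 = - g (- 1)" if "a \<noteq> b" for a b
    using K_eq_aux[OF that, of 1] by simp
  have "- g (- 1) = g (- 1) * g (- 1)"
    using G_K_mult(2)[OF ij, of 1 1] by (simp add: K[OF ij(1)] K[OF ij(2)] K[OF ij(3)])
  also have "\<dots> = 1" using g_mult[of "- 1" "- 1"] by simp
  finally have "- (- g (- 1)) = - 1" by (rule arg_cong)
  then show ?thesis by simp
qed

lemma g_minus: "g (- z) = - g z"
  using g_mult[of "- 1" z] by (simp add: g_minus_one)

lemma K_eq: "i \<noteq> j \<Longrightarrow> K i j z = g (cnj z)"
  by (cases "z = 0") (simp_all add: K_eq_aux g_minus)

lemma g_add: "g (z + w) = g z + g w"
proof (cases "w = 0")
  case False
  \<comment> \<open>Sums 1 + a suffice: multiplicativity gives the others after factoring out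
    w.\<close>
  have 1: "g (1 + a) = 1 + g a" for a
  proof -
    obtain i j k :: 'n where ij: "i \<noteq> j" "i \<noteq> k" "j \<noteq> k" using three_indices by blast
    define b where "b = - 1 - a"
    define x where "x = vec3 i j k 1 1 1"
    define y where "y = vec3 i j k 1 a b"
    have x: "x \<noteq> 0" "x $ i = 1" "x $ j = 1" "x $ k = 1" and y: "y \<noteq> 0" "y $ i = 1" "y $ j = a" "y $ k = b"
      using ij by (auto simp: x_def y_def vec3_nz) (auto simp: vec3_def)
    have supp: "x $ l = 0" if "l \<noteq> i" "l \<noteq> j" "l \<noteq> k" for l using that by (simp add: x_def vec3_def)
    have "cip x y = 0"
      unfolding y_def cip_vec3[OF ij] using x by (simp add: b_def)
    then have "(\<Sum>l\<in>UNIV. f x $ i $ l * f y $ l $ i) = 0" by (intro orth x y)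
    moreover have "(\<Sum>l\<in>UNIV. f x $ i $ l * f y $ l $ i)
        = f x $ i $ i * f y $ i $ i + f x $ i $ j * f y $ j $ i + f x $ i $ k * f y $ k $ i"
      by (rule sum_three[OF ij]) (simp add: support(1)[OF x(1) supp])
    moreover have "f x $ i $ j = f x $ i $ i" "f x $ i $ k = f x $ i $ i"
      using columns[OF x(1), of i j i] columns[OF x(1), of i k i] x ij by (simp_all add: K_eq)
    moreover have "f y $ j $ i = g a * f y $ i $ i" "f y $ k $ i = g b * f y $ i $ i"
      using rows[OF y(1), of i j i] rows[OF y(1), of i k i] y ij by (simp_all add: G_eq)
    ultimately have "f x $ i $ i * f y $ i $ i * (1 + g a + g b) = 0" by (simp add: algebra_simps)
    then have "1 + g a + g b = 0" using diag_nz[OF x(1), of i] diag_nz[OF y(1), of i] x y by simp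
    moreover have "b = - (1 + a)" by (simp add: b_def)
    then have "g b = - g (1 + a)" by (simp only: g_minus)
    ultimately show ?thesis by (simp add: algebra_simps eq_neg_iff_add_eq_0)
  qed
  have "z + w = w * (1 + z / w)" using False by (simp add: field_simps)
  then have "g (z + w) = g w * (1 + g (z / w))" by (simp only: g_mult 1)
  also have "\<dots> = g z + g w" using False by (simp add: distrib_left g_mult[symmetric])
  finally show ?thesis .
qed simp

lemma continuous_g: "continuous_on UNIV g"
proof -
  obtain i j k :: 'n where ij: "i \<noteq> j" "i \<noteq> k" "j \<noteq> k" using three_indices by blast
  have "continuous_on UNIV (\<lambda>z. E i j z $ j $ i / E i j z $ i $ i)"
    using E_diag_nz[OF ij(1)] by (intro continuous_on_divide continuous_E continuous_on_id) auto
  moreover have "g = (\<lambda>z. E i j z $ j $ i / E i j z $ i $ i)"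
    using G_eq[OF ij(1)] by (auto simp: G_def fun_eq_iff)
  ultimately show ?thesis by simp
qed

lemma g_of_real: "g (of_real r) = of_real r"
proof -
  have nat: "g (of_nat m) = of_nat m" for m by (induction m) (simp_all add: g_add)
  have int: "g (of_int m) = of_int m" for m
    by (cases m) (simp_all add: nat g_minus g_minus_one g_add del: of_nat_Suc add: nat[of "Suc _"])
  have rat: "g (of_real q) = of_real q" if q_rat: "q \<in> \<rat>" for q
  proof -
    obtain m n :: int where q: "q = of_int m / of_int n" "n \<noteq> 0"
      using Rats_cases'[OF q_rat] by (metis less_irrefl)
    have prod: "of_real q * of_int n = (of_int m :: complex)" using q by simp
    have "g (of_real q) * of_int n = of_real q * of_int n"
      using g_mult[of "of_real q" "of_int n"] by (simp only: prod int)
    then show ?thesis using q(2) by simp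
  qed
  have "closed {r :: real. g (of_real r) = of_real r}"
    by (intro closed_Collect_eq continuous_on_compose2[OF continuous_g] continuous_on_of_real
        continuous_on_id) auto
  moreover have "\<rat> \<subseteq> {r :: real. g (of_real r) = of_real r}" using rat by auto
  ultimately have "closure \<rat> \<subseteq> {r :: real. g (of_real r) = of_real r}" by (intro closure_minimal)
  then show ?thesis by (auto simp: Rats_closure_real)
qed

lemma g_cases: "g = (\<lambda>z. z) \<or> g = cnj"
proof -
  have "g \<i> * g \<i> = - 1" using g_mult[of \<i> \<i>] by (simp add: g_minus_one)
  then have "(g \<i> - \<i>) * (g \<i> + \<i>) = 0" by (simp add: algebra_simps)
  then have i: "g \<i> = \<i> \<or> g \<i> = - \<i>" by (auto simp: eq_neg_iff_add_eq_0)
  have rep: "g z = of_real (Re z) + g \<i> * of_real (Im z)" for z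
    using g_add[of "of_real (Re z)" "\<i> * of_real (Im z)"]
    by (simp add: g_mult g_of_real complex_eq[symmetric])
  from i show ?thesis
  proof
    assume "g \<i> = \<i>"
    then have "g z = z" for z by (subst rep) (simp add: complex_eq_iff)
    then show ?thesis by auto
  next
    assume "g \<i> = - \<i>"
    then have "g z = cnj z" for z by (subst rep) (simp add: complex_eq_iff)
    then show ?thesis by auto
  qed
qed

theorem f_cases: "(\<forall>x. norm x = 1 \<longrightarrow> f x = outer x) \<or> (\<forall>x. norm x = 1 \<longrightarrow> f x = transpose (outer x))"
proof -
  have form: "f x $ j $ l = g (x $ j) * g (cnj (x $ l))" if x: "norm x = 1" for x j l
  proof -
    have x0: "x \<noteq> 0" using x by auto
    then obtain i where i: "x $ i \<noteq> 0" by (auto simp: vec_eq_iff)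
    \<comment> \<open>The scalar that the ratios leave undetermined. The trace fixes it, since
      \<open>g a * g (cnj a)\<close> is the squared modulus of a for both candidates of g.\<close>
    define \<mu> where "\<mu> = f x $ i $ i / (g (x $ i) * g (cnj (x $ i)))"
    have nz: "g (x $ i) \<noteq> 0" "g (cnj (x $ i)) \<noteq> 0" 
      using i g_nz[of "x $ i"] g_nz[of "cnj (x $ i)"] by auto
    have quot: "g (a / b) = g a / g b" if "b \<noteq> 0" for a b
      using that g_mult[of "a / b" b] g_nz[OF that] by (simp add: field_simps)
    have entry: "f x $ j $ l = \<mu> * (g (x $ j) * g (cnj (x $ l)))" for j l
    proof -
      have "f x $ j $ l = g (x $ j / x $ i) * f x $ i $ l"
        using rows[OF x0 i, of j l] i by (cases "i = j") (simp_all add: G_eq)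
      also have "f x $ i $ l = g (cnj (x $ l / x $ i)) * f x $ i $ i"
        using columns[OF x0 i, of l i] i by (cases "i = l") (simp_all add: K_eq)
      finally show ?thesis using i nz by (simp add: \<mu>_def quot field_simps)
    qed
    have gg: "g a * g (cnj a) = a * cnj a" for a
      using g_cases by (auto simp: mult.commute)
    have "1 = \<mu> * (\<Sum>j\<in>UNIV. x $ j * cnj (x $ j))"
      using trace1[OF x0] by (simp add: entry gg sum_distrib_left)
    also have "(\<Sum>j\<in>UNIV. x $ j * cnj (x $ j)) = 1"
      using cip_self_eq_1[of x] x by (simp add: cip_def)
    finally show ?thesis using entry by simp
  qed
  from g_cases show ?thesis
  proof
    assume "g = (\<lambda>z. z)"
    then show ?thesis by (auto simp: vec_eq_iff form outer_def)
  next
    assume "g = cnj"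
    then show ?thesis by (auto simp: vec_eq_iff form outer_def transpose_def mult.commute)
  qed
qed

end

text \<open>Conjugation by a diagonal matrix with entries c multiplies \<open>G i j\<close> by
  \<open>c i / c j\<close> and keeps the images of the axes. With \<open>c j\<close> the value of
  \<open>G r j 1\<close> for a reference index r, the cocycle law makes every new ratio at 1 equal
  to 1.\<close>

lemma (in proj_map) similar_to_outer:
  "\<exists>P. invertible P \<and> ((\<forall>x. norm x = 1 \<longrightarrow> f x = P ** outer x ** matrix_inv P) \<or>
    (\<forall>x. norm x = 1 \<longrightarrow> f x = P ** transpose (outer x) ** matrix_inv P))"
proof -
  define r :: 'n where "r = undefined"
  define c where "c j = (if j = r then 1 else G r j 1)" for j
  have c: "c j \<noteq> 0" for j using G_nz[of r j 1] by (simp add: c_def)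
  define f' where "f' x = (\<chi> i j. f x $ i $ j * c j / c i)" for x
  have entry: "f' x $ i $ j = f x $ i $ j * c j / c i" for x i j by (simp add: f'_def)
  interpret N: proj_map f'
  proof
    show "f' x $ i $ j * f' x $ k $ l = f' x $ i $ l * f' x $ k $ j" if "x \<noteq> 0" for x i j k l
    proof -
      have "f' x $ i $ j * f' x $ k $ l = (f x $ i $ j * f x $ k $ l) * (c j * c l / (c i * c k))"
        by (simp add: entry)
      also have "\<dots> = f' x $ i $ l * f' x $ k $ j"
        by (simp add: entry rank1[OF that, of i j k l])
      finally show ?thesis .
    qed
    show "(\<Sum>k\<in>UNIV. f' x $ i $ k * f' y $ k $ j) = 0" if "x \<noteq> 0" "y \<noteq> 0" "cip x y = 0" for x y i j
    proof -
      have "(\<Sum>k\<in>UNIV. f' x $ i $ k * f' y $ k $ j) = (\<Sum>k\<in>UNIV. (c j / c i) * (f x $ i $ k * f y $ k $ j))"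
        using c by (intro sum.cong) (auto simp: entry)
      then show ?thesis by (simp only: sum_distrib_left[symmetric] orth[OF that]) simp
    qed
    show "continuous_on {x. x \<noteq> 0} f'"
      unfolding f'_def using c
      by (intro continuous_on_vec_lambda continuous_on_divide continuous_on_mult
          continuous_on_component continuous_on_const cont) auto
    show "f' (axis i 1) $ j $ k = (if j = i \<and> k = i then 1 else 0)" for i j k
      using c by (simp add: entry axis)
  qed (use c in \<open>simp_all add: dim3 entry trace1 f'_def scale\<close>)
  interpret N: normalized_proj_map f'
  proof
    fix i j :: 'n assume ij: "i \<noteq> j"
    have "N.G i j 1 = G i j 1 * c i / c j"
      using c[of i] c[of j] by (simp add: N.G_def N.E_def G_def E_def entry)
    also have "G i j 1 * c i = c j"
    proof (cases "i = r \<or> j = r")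
      case True
      then show ?thesis using ij G_inverse[OF ij, of 1] by (auto simp: c_def)
    next
      case False
      then show ?thesis using ij G_K_mult(1)[of r i j 1 1] by (auto simp: c_def mult.commute)
    qed
    finally show "N.G i j 1 = 1" using c by simp
  qed
  have "diag_mat c ** diag_mat (\<lambda>i. 1 / c i) = mat 1"
    using c by (simp add: diag_mat_mult diag_mat_one)
  then have inv: "invertible (diag_mat c)" "matrix_inv (diag_mat c) = diag_mat (\<lambda>i. 1 / c i)"
    by (auto simp: invertible_right_inverse intro: matrix_inv_unique)
  have "f x = diag_mat c ** f' x ** matrix_inv (diag_mat c)" for x
    using c by (simp add: inv(2) vec_eq_iff diag_mat_mult_left diag_mat_mult_right entry)
  then show ?thesis using inv(1) N.f_cases by (intro exI[of _ "diag_mat c"]) auto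
qed

section \<open>From rank-one projections to all self-adjoint matrices\<close>

context CS_map begin

lemma linear_form:
  assumes n: "CARD('n) \<ge> 3"
    and orth: "\<And>a b. norm a = 1 \<Longrightarrow> norm b = 1 \<Longrightarrow> cip a b = 0 \<Longrightarrow> \<phi> (outer a) ** \<phi> (outer b) = 0"
  shows "\<exists>T. invertible T \<and>
    ((\<forall>X\<in>self_adjoint_matrices. \<phi> X = T ** X ** matrix_inv T) \<or>
     (\<forall>X\<in>self_adjoint_matrices. \<phi> X = T ** transpose X ** matrix_inv T))"
proof -
  have form: "\<exists>T. invertible T \<and> (\<forall>k. \<phi> (outer (u k)) = cproj T {k}) \<and>
      (\<forall>d. increasing d \<longrightarrow> \<phi> (spec u d) = (\<Sum>k\<in>UNIV. d $ k *\<^sub>R \<phi> (outer (u k))))"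
    if "frame u" for u
    by (rule orthogonal_form[OF _ that]) (rule orth)
  obtain T where T: "invertible T" and T_axis: "\<forall>k. \<phi> (outer (axis k 1)) = cproj T {k}"
    using form[OF standard_frame] by (elim exE conjE)
  have inv_inv: "matrix_inv (matrix_inv T) = T"
    by (rule matrix_inv_unique[OF matrix_inv_left[OF T]])
  \<comment> \<open>Division by the squared norm extends the map from unit vectors to all nonzero
    vectors and makes it a function of the line.\<close>
  define F where "F x = \<phi> ((1 / (norm x)\<^sup>2) *\<^sub>R outer x)" for x
  define f where "f x = matrix_inv T ** F x ** T" for x
  define unit where "unit x = (1 / norm x) *\<^sub>R x" for x :: "(complex, 'n) vec"
  have outer_unit: "(1 / (norm x)\<^sup>2) *\<^sub>R outer x = outer (unit x)" for x
    by (simp add: outer_def vec_eq_iff unit_def power2_eq_square)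
  have F_unit: "F x = \<phi> (outer (unit x))" for x by (simp add: F_def outer_unit)
  have norm_unit: "norm (unit x) = 1" if "x \<noteq> 0" for x using that by (simp add: unit_def)
  have F_cproj: "\<exists>R k. invertible R \<and> F x = cproj R {k}" if x: "x \<noteq> 0" for x
  proof -
    have "orthonormal {unit x}" using norm_unit[OF x] by (auto simp: orthonormal_def cip_self_eq_1)
    then obtain B where B: "{unit x} \<subseteq> B" "orthonormal B" "card B = CARD('n)"
      using orthonormal_extend_basis[of "{unit x}"] n by auto
    obtain u where u: "frame u" "range u = B" using frame_of_basis[OF B(2,3)] by auto
    obtain k where k: "u k = unit x" using B(1) u(2) by auto
    obtain R where "invertible R" "\<phi> (outer (u k)) = cproj R {k}"
      using form[OF u(1)] by (elim exE conjE) simp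
    then show ?thesis using k by (auto simp: F_unit)
  qed
  interpret f: proj_map f
  proof
    show "f x $ i $ j * f x $ k $ l = f x $ i $ l * f x $ k $ j" if x: "x \<noteq> 0" for x i j k l
    proof -
      obtain R m where R: "F x = cproj R {m}" using F_cproj[OF x] by auto
      have fx: "f x = (matrix_inv T ** R) ** diag_mat (\<lambda>i. of_bool (i \<in> {m})) ** (matrix_inv R ** T)"
        by (simp only: f_def R cproj_def matrix_mul_assoc)
      have "(A ** diag_mat (\<lambda>i. of_bool (i \<in> {m})) ** B) $ i $ j = A $ i $ m * B $ m $ j"
        for A B :: "'n cmatrix" and i j
      proof -
        have "(A ** diag_mat (\<lambda>i. of_bool (i \<in> {m})) ** B) $ i $ j
            = (\<Sum>k\<in>UNIV. (A ** diag_mat (\<lambda>i. of_bool (i \<in> {m}))) $ i $ k * B $ k $ j)"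
          by (simp only: matrix_matrix_mult_def[of "A ** _"] vec_lambda_beta)
        also have "\<dots> = (\<Sum>k\<in>UNIV. if k = m then A $ i $ k * B $ k $ j else 0)"
          by (intro sum.cong) (auto simp: diag_mat_mult_right)
        finally show ?thesis by simp
      qed
      then show ?thesis by (simp add: fx)
    qed
    show "(\<Sum>i\<in>UNIV. f x $ i $ i) = 1" if x: "x \<noteq> 0" for x
    proof -
      obtain R m where R: "invertible R" "F x = cproj R {m}" using F_cproj[OF x] by auto
      have "trace (f x) = trace (F x)"
        using trace_conj[OF invertible_matrix_inv[OF T]] by (simp add: f_def inv_inv)
      then show ?thesis by (simp add: R trace_cproj trace_def[symmetric])
    qed
    show "f (c *s x) = f x" if "x \<noteq> 0" "c \<noteq> 0" for x c
    proof -
      have "complex_of_real ((norm (c *s x))\<^sup>2) = of_real ((cmod c)\<^sup>2 * (norm x)\<^sup>2)"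
        by (simp only: cip_self[symmetric] cip_scale of_real_mult complex_norm_square mult_ac)
      then have "(norm (c *s x))\<^sup>2 = (cmod c)\<^sup>2 * (norm x)\<^sup>2" using of_real_eq_iff by blast
      then show ?thesis using that by (simp add: f_def F_def outer_scale)
    qed
    show "(\<Sum>k\<in>UNIV. f x $ i $ k * f y $ k $ j) = 0" if "x \<noteq> 0" "y \<noteq> 0" "cip x y = 0" for x y i j
    proof -
      have "F x ** F y = 0"
        unfolding F_unit using that by (intro orth norm_unit) (auto simp: unit_def cip_scaleR)
      then have "f x ** f y = 0"
        using conj_mult[OF invertible_matrix_inv[OF T], of "F x" "F y"] by (simp add: f_def inv_inv)
      then have "(f x ** f y) $ i $ j = 0" by simp
      then show ?thesis by (simp add: matrix_matrix_mult_def)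
    qed
    show "continuous_on {x. x \<noteq> 0} f"
      unfolding f_def F_def
      by (intro continuous_on_matrix_mult continuous_on_const continuous_on_phi_compose
          continuous_on_scaleR continuous_on_divide continuous_on_power continuous_on_norm
          continuous_on_outer continuous_on_id self_adjoint_scaleR self_adjoint_outer) auto
    show "f (axis i 1) $ j $ k = (if j = i \<and> k = i then 1 else 0)" for i j k
    proof -
      have "F (axis i 1) = cproj T {i}" using frame_norm[OF standard_frame, of i] by (simp add: F_def T_axis)
      then have "f (axis i 1) = diag_mat (\<lambda>k. of_bool (k \<in> {i}))"
        by (simp add: f_def cproj_def conj_cancel(1)[OF T])
      then show ?thesis by (simp add: diag_mat_def)
    qed
  qed (rule n)
  obtain P where P: "invertible P" and
    cases: "(\<forall>x. norm x = 1 \<longrightarrow> f x = P ** outer x ** matrix_inv P) \<or>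
      (\<forall>x. norm x = 1 \<longrightarrow> f x = P ** transpose (outer x) ** matrix_inv P)"
    using f.similar_to_outer by auto
  define S where "S = T ** P"
  have "S ** (matrix_inv P ** matrix_inv T) = T ** (P ** matrix_inv P) ** matrix_inv T"
    by (simp only: S_def matrix_mul_assoc)
  then have "S ** (matrix_inv P ** matrix_inv T) = mat 1"
    by (simp add: matrix_inv_right[OF P] matrix_inv_right[OF T])
  then have S: "invertible S" "matrix_inv S = matrix_inv P ** matrix_inv T"
    by (auto simp: invertible_right_inverse intro: matrix_inv_unique)
  have \<phi>_f: "\<phi> (outer x) = S ** A ** matrix_inv S"
    if "norm x = 1" "f x = P ** A ** matrix_inv P" for x A
  proof -
    have "\<phi> (outer x) = T ** f x ** matrix_inv T"
      using that(1) by (simp add: f_def F_def conj_cancel(2)[OF T])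
    then show ?thesis unfolding that(2) S(2) by (simp only: S_def matrix_mul_assoc)
  qed
  \<comment> \<open>A formula for rank-one projections carries over to every self-adjoint matrix
    when h is linear along spectral decompositions; h is the identity or the transpose
    below.\<close>
  have extend: "\<phi> X = S ** h X ** matrix_inv S"
    if X: "X \<in> self_adjoint_matrices" and h: "\<And>x. norm x = 1 \<Longrightarrow> \<phi> (outer x) = S ** h (outer x) ** matrix_inv S"
      and lin: "\<And>u d. h (spec u d) = (\<Sum>k\<in>UNIV. d $ k *\<^sub>R h (outer (u k)))" for X h
  proof -
    obtain u d where ud: "frame u" "increasing d" "X = spec u d" using spectral_theorem[OF X] by auto
    then have "\<phi> X = (\<Sum>k\<in>UNIV. d $ k *\<^sub>R \<phi> (outer (u k)))"
      using form[OF ud(1)] by (elim exE conjE) simp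
    also have "\<dots> = (\<Sum>k\<in>UNIV. d $ k *\<^sub>R (S ** h (outer (u k)) ** matrix_inv S))"
      using ud(1) by (intro sum.cong) (auto simp: h frame_norm)
    also have "\<dots> = S ** h X ** matrix_inv S"
      by (simp add: ud lin matrix_mult_sum matrix_mult_scaleR)
    finally show ?thesis .
  qed
  have trans: "transpose (spec u d) = (\<Sum>k\<in>UNIV. d $ k *\<^sub>R transpose (outer (u k)))" for u d
    by (simp add: spec_def transpose_def vec_eq_iff)
  from cases show ?thesis
  proof
    assume "\<forall>x. norm x = 1 \<longrightarrow> f x = P ** outer x ** matrix_inv P"
    then have "\<phi> X = S ** X ** matrix_inv S" if "X \<in> self_adjoint_matrices" for X
      using extend[OF that, of "\<lambda>X. X"] \<phi>_f by (simp add: spec_def)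
    then show ?thesis using S(1) by auto
  next
    assume *: "\<forall>x. norm x = 1 \<longrightarrow> f x = P ** transpose (outer x) ** matrix_inv P"
    have "\<phi> X = S ** transpose X ** matrix_inv S" if "X \<in> self_adjoint_matrices" for X
      by (rule extend[OF that \<phi>_f trans]) (use * in auto)
    then show ?thesis using S(1) by auto
  qed
qed

end

theorem theoremB:
  fixes \<phi> :: "('n::{finite,linorder}) cmatrix \<Rightarrow> 'n cmatrix"
  assumes "CARD('n) \<ge> 3"
  shows "continuous_on self_adjoint_matrices \<phi> \<and> CS_preserving_on self_adjoint_matrices \<phi> \<longleftrightarrow>
    (\<exists>T :: 'n cmatrix. invertible T \<and>
      ((\<forall>X\<in>self_adjoint_matrices. \<phi> X = T ** X ** matrix_inv T) \<or>
       (\<forall>X\<in>self_adjoint_matrices. \<phi> X = T ** transpose X ** matrix_inv T))) \<or>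
    (\<exists>T :: 'n cmatrix. invertible T \<and>
      (\<forall>X\<in>self_adjoint_matrices. \<phi> X = T ** sorted_eigenvalue_diag X ** matrix_inv T))"
    (is "?CS \<longleftrightarrow> ?linear \<or> ?sorted")
proof
  assume ?CS
  then interpret CS_map \<phi> by unfold_locales auto
  from orthogonal_pair_dichotomy[OF assms] show "?linear \<or> ?sorted"
  proof
    assume "\<forall>a b. norm a = 1 \<longrightarrow> norm b = 1 \<longrightarrow> cip a b = 0 \<longrightarrow> \<phi> (outer a) = \<phi> (outer b)"
    then have ?sorted by (intro sorted_form[OF assms]) auto
    then show ?thesis ..
  next
    assume "\<forall>a b. norm a = 1 \<longrightarrow> norm b = 1 \<longrightarrow> cip a b = 0 \<longrightarrow> \<phi> (outer a) ** \<phi> (outer b) = 0"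
    then have ?linear by (intro linear_form[OF assms]) auto
    then show ?thesis ..
  qed
next
  assume "?linear \<or> ?sorted"
  then consider
    (id) T where "invertible T" "\<And>X. X \<in> self_adjoint_matrices \<Longrightarrow> \<phi> X = T ** X ** matrix_inv T"
  | (transpose) T where "invertible T"
      "\<And>X. X \<in> self_adjoint_matrices \<Longrightarrow> \<phi> X = T ** transpose X ** matrix_inv T"
  | (sorted) T where "invertible T"
      "\<And>X. X \<in> self_adjoint_matrices \<Longrightarrow> \<phi> X = T ** sorted_eigenvalue_diag X ** matrix_inv T"
    by auto
  then show ?CS
  proof cases
    case id
    then show ?thesis
      by (rule classified_imp_CS_preserving) (auto intro: CS_preserving_id continuous_on_id)
  next
    case transpose
    then show ?thesis
      by (rule classified_imp_CS_preserving) (auto intro: CS_preserving_transpose continuous_on_transpose)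
  next
    case sorted
    then show ?thesis
      by (rule classified_imp_CS_preserving)
        (auto intro: CS_preserving_sorted_eigenvalue_diag continuous_on_sorted_eigenvalue_diag)
  qed
qed

end
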